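(* Fix an equation $(f,q,w)$ as in the context. Let $K=(k_{ij})\in SL(2,\mathbb R)$, $\gamma\in(-\pi,\pi]$, and write $\lambda_n(e^{i\gamma}K)$ for the eigenvalues with boundary condition $[e^{i\gamma}K\,|\,-I]$. Let $\mathbf S_K=\begin{pmatrix}1&0&0&0\\0&0&-k_{22}&k_{12}\end{pmatrix}$ and $\mathbf V_K=\begin{pmatrix}k_{21}&k_{22}&0&0\\0&0&0&1\end{pmatrix}$. Then the problem with $\mathbf S_K$ has exactly $N$ eigenvalues if $k_{12}\ne0$ and $N-1$ if $k_{12}=0$; with $\mathbf V_K$ exactly $N$ if $f_0k_{22}-k_{21}\ne0$ and $N-1$ if $f_0k_{22}-k_{21}=0$. Furthermore: (i) if $k_{12}=0$: $\lambda_n(e^{i\gamma}K)\le\lambda_n(\mathbf S_K)\le\lambda_{n+1}(e^{i\gamma}K)$ for $0\le n\le N-2$; if $(k_{11}-f_0k_{12})k_{12}>0$: $\lambda_n(\mathbf S_K)\le\lambda_n(e^{i\gamma}K)$ for $0\le n\le N-1$ and $\lambda_n(e^{i\gamma}K)\le\lambda_{n+1}(\mathbf S_K)$ for $0\le n\le N-2$; if $(k_{11}-f_0k_{12})k_{12}<0$: $\lambda_n(e^{i\gamma}K)\le\lambda_n(\mathbf S_K)$ for $0\le n\le N-1$ and $\lambda_n(\mathbf S_K)\le\lambda_{n+1}(e^{i\gamma}K)$ for $0\le n\le N-2$; if $k_{11}-f_0k_{12}=0$: $\lambda_n(\mathbf S_K)\le\lambda_n(e^{i\gamma}K)\le\lambda_{n+1}(\mathbf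 S_K)$ for $0\le n\le N-2$; (ii) if $f_0k_{22}-k_{21}=0$: $\lambda_n(e^{i\gamma}K)\le\lambda_n(\mathbf V_K)\le\lambda_{n+1}(e^{i\gamma}K)$ for $0\le n\le N-2$; if $(k_{11}-f_0k_{12})(f_0k_{22}-k_{21})>0$: $\lambda_n(\mathbf V_K)\le\lambda_n(e^{i\gamma}K)$ for $0\le n\le N-1$ and $\lambda_n(e^{i\gamma}K)\le\lambda_{n+1}(\mathbf V_K)$ for $0\le n\le N-2$; if $(k_{11}-f_0k_{12})(f_0k_{22}-k_{21})<0$: $\lambda_n(e^{i\gamma}K)\le\lambda_n(\mathbf V_K)$ for $0\le n\le N-1$ and $\lambda_n(\mathbf V_K)\le\lambda_{n+1}(e^{i\gamma}K)$ for $0\le n\le N-2$; if $k_{11}-f_0k_{12}=0$: $\lambda_n(\mathbf V_K)\le\lambda_n(e^{i\gamma}K)\le\lambda_{n+1}(\mathbf V_K)$ for $0\le n\le N-2$.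
   Context: Let $N\ge2$ be an integer. An equation is given by real sequences $f=\{f_n\}_{n=0}^N$, $q=\{q_n\}_{n=1}^N$, $w=\{w_n\}_{n=1}^N$ with $f_n\neq0$, $w_n>0$; it is $-\nabla(f_n\Delta y_n)+q_ny_n=\lambda w_ny_n$, $1\le n\le N$, for $y=\{y_n\}_{n=0}^{N+1}$, $\Delta y_n=y_{n+1}-y_n$, $\nabla y_n=y_n-y_{n-1}$. A boundary condition $[A\,|\,B]$ (equivalently the $2\times4$ coefficient matrix $(A,B)$ of rank 2) is $A(y_0,f_0\Delta y_0)^T+B(y_N,f_N\Delta y_N)^T=0$; matrices differing by left multiplication by an invertible $2\times2$ complex matrix give the same condition. $SL(2,\mathbb R)$ is the set of real $2\times2$ matrices of determinant 1. The problem with $[e^{i\gamma}K|-I]$ has $N$ eigenvalues if $k_{11}-f_0k_{12}\neq0$ and $N-1$ otherwise. Eigenvalues ($\lambda$ with a nontrivial solution) of these self-adjoint problems are real; multiplicity = dimension of the solution space (equal to the multiplicity as a zero of the characteristic polynomial); counted with multiplicity they are ordered $\lambda_0\le\lambda_1\le\cdots$, and "exactly $k$ eigenvalues" counts multiplicity. *)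

theory Defs
  imports Complex_Main "HOL-Library.Function_Algebras"
begin

text \<open>Sequences f = (f 0 .. f N), q, w = (q 1 .. q N), (w 1 .. w N) are real functions on nat;
  only the indicated indices matter.  A solution y = (y 0 .. y (N+1)) is a complex function on nat,
  normalised to vanish beyond N+1 so that solution sets are linear subspaces.

  A boundary condition is a 2x4 complex matrix M = (A,B), given as a function of
  (row, column), rows 0,1 and columns 0..3; it means
  A (y 0, f 0 * Delta y 0)^T + B (y N, f N * Delta y N)^T = 0.\<close>

definition sl_eq :: "(nat \<Rightarrow> real) \<Rightarrow> (nat \<Rightarrow> real) \<Rightarrow> (nat \<Rightarrow> real) \<Rightarrow> nat \<Rightarrow> complex \<Rightarrow> (nat \<Rightarrow> complex) \<Rightarrow> bool" where
  "sl_eq f q w N lam y \<longleftrightarrow>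
     (\<forall>n\<in>{1..N}.
        - (of_real (f n) * (y (Suc n) - y n) - of_real (f (n - 1)) * (y n - y (n - 1)))
        + of_real (q n) * y n = lam * of_real (w n) * y n)"

definition bc_holds :: "(nat \<Rightarrow> real) \<Rightarrow> nat \<Rightarrow> (nat \<Rightarrow> nat \<Rightarrow> complex) \<Rightarrow> (nat \<Rightarrow> complex) \<Rightarrow> bool" where
  "bc_holds f N M y \<longleftrightarrow>
     (\<forall>i<2. M i 0 * y 0 + M i 1 * (of_real (f 0) * (y 1 - y 0))
            + M i 2 * y N + M i 3 * (of_real (f N) * (y (Suc N) - y N)) = 0)"

definition sol_space :: "(nat \<Rightarrow> real) \<Rightarrow> (nat \<Rightarrow> real) \<Rightarrow> (nat \<Rightarrow> real) \<Rightarrow> nat \<Rightarrow> (nat \<Rightarrow> nat \<Rightarrow> complex) \<Rightarrow> complex \<Rightarrow> (nat \<Rightarrow> complex) set" where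
  "sol_space f q w N M lam =
     {y. (\<forall>n>Suc N. y n = 0) \<and> sl_eq f q w N lam y \<and> bc_holds f N M y}"

definition is_eig :: "(nat \<Rightarrow> real) \<Rightarrow> (nat \<Rightarrow> real) \<Rightarrow> (nat \<Rightarrow> real) \<Rightarrow> nat \<Rightarrow> (nat \<Rightarrow> nat \<Rightarrow> complex) \<Rightarrow> complex \<Rightarrow> bool" where
  "is_eig f q w N M lam \<longleftrightarrow> (\<exists>y\<in>sol_space f q w N M lam. y \<noteq> 0)"

definition eig_mult :: "(nat \<Rightarrow> real) \<Rightarrow> (nat \<Rightarrow> real) \<Rightarrow> (nat \<Rightarrow> real) \<Rightarrow> nat \<Rightarrow> (nat \<Rightarrow> nat \<Rightarrow> complex) \<Rightarrow> complex \<Rightarrow> nat" where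
  "eig_mult f q w N M lam =
     vector_space.dim (\<lambda>(c::complex) (y::nat \<Rightarrow> complex). (\<lambda>n. c * y n)) (sol_space f q w N M lam)"

definition has_eigs :: "(nat \<Rightarrow> real) \<Rightarrow> (nat \<Rightarrow> real) \<Rightarrow> (nat \<Rightarrow> real) \<Rightarrow> nat \<Rightarrow> (nat \<Rightarrow> nat \<Rightarrow> complex) \<Rightarrow> nat \<Rightarrow> bool" where
  "has_eigs f q w N M k \<longleftrightarrow>
     finite {lam. is_eig f q w N M lam} \<and> (\<Sum>lam\<in>{lam. is_eig f q w N M lam}. eig_mult f q w N M lam) = k"

text \<open>The n-th eigenvalue (from 0) in the nondecreasing ordering with multiplicity:
  the least real x such that more than n eigenvalues (with multiplicity) are \<le> x.\<close>
definition eigv :: "(nat \<Rightarrow> real) \<Rightarrow> (nat \<Rightarrow> real) \<Rightarrow> (nat \<Rightarrow> real) \<Rightarrow> nat \<Rightarrow> (nat \<Rightarrow> nat \<Rightarrow> complex) \<Rightarrow> nat \<Rightarrow> real" where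
  "eigv f q w N M n =
     (LEAST x::real. n < (\<Sum>t\<in>{t::real. is_eig f q w N M (of_real t) \<and> t \<le> x}. eig_mult f q w N M (of_real t)))"

definition mat24 :: "complex list \<Rightarrow> complex list \<Rightarrow> nat \<Rightarrow> nat \<Rightarrow> complex" where
  "mat24 r0 r1 = (\<lambda>i j. (if i = 0 then r0 else r1) ! j)"

definition coupled_bc :: "real \<Rightarrow> real \<Rightarrow> real \<Rightarrow> real \<Rightarrow> real \<Rightarrow> nat \<Rightarrow> nat \<Rightarrow> complex" where
  "coupled_bc \<gamma> k11 k12 k21 k22 =
     mat24 [cis \<gamma> * of_real k11, cis \<gamma> * of_real k12, -1, 0]
           [cis \<gamma> * of_real k21, cis \<gamma> * of_real k22, 0, -1]"

definition S_bc :: "real \<Rightarrow> real \<Rightarrow> real \<Rightarrow> real \<Rightarrow> nat \<Rightarrow> nat \<Rightarrow> complex" where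
  "S_bc k11 k12 k21 k22 = mat24 [1, 0, 0, 0] [0, 0, - of_real k22, of_real k12]"

definition V_bc :: "real \<Rightarrow> real \<Rightarrow> real \<Rightarrow> real \<Rightarrow> nat \<Rightarrow> nat \<Rightarrow> complex" where
  "V_bc k11 k12 k21 k22 = mat24 [of_real k21, of_real k22, 0, 0] [0, 0, 0, 1]"

end

theory Submission
  imports Defs "HOL-Computational_Algebra.Fundamental_Theorem_Algebra"
begin

text \<open>
  Write \<open>u = (y 1, \<dots>, y N)\<close> for the interior part of a sequence. A boundary condition either
  determines \<open>y 0\<close> and \<open>y (N + 1)\<close> from \<open>u\<close>, and the problem is a Hermitian pencil on \<open>\<complex>^N\<close>, or it
  confines \<open>u\<close> to a hyperplane, and the problem is the compression of such a pencil. Hence there is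
  an orthonormal family of \<open>N\<close> respectively \<open>N - 1\<close> eigenfunctions. With \<open>d = k11 - f 0 * k12\<close> and
  \<open>g = f 0 * k22 - k21\<close>, the quadratic form of the coupled problem minus that of \<open>S\<close> (of \<open>V\<close>) on a
  common interior part is \<open>d / k12 * |y 0|^2\<close> (is \<open>d / g * |f N * (y (N + 1) - y N)|^2\<close>), where the
  quotient is to be read as 0 if the denominator vanishes; these are semidefinite forms of rank one,
  and the inequalities follow as in the Courant--Fischer proof of interlacing.
\<close>

section \<open>Linear systems and counting functions\<close>

text \<open>Gaussian elimination, by induction on the rows. It carries every dimension argument
  below, with the coordinates of vectors as rows and the vectors as unknowns.\<close>

lemma homogeneous_system_nontrivial_solution:
  fixes A :: "'r \<Rightarrow> 'c \<Rightarrow> 'a :: field"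
  assumes "finite R" "finite C" "card R < card C"
  shows "\<exists>c. (\<exists>i\<in>C. c i \<noteq> 0) \<and> (\<forall>r\<in>R. (\<Sum>i\<in>C. A r i * c i) = 0)"
  using assms
proof (induction R arbitrary: C A rule: finite_induct)
  case empty
  then have "C \<noteq> {}" by auto
  then show ?case by (intro exI[of _ "\<lambda>_. 1"]) auto
next
  case (insert r R)
  show ?case
  proof (cases "\<forall>i\<in>C. A r i = 0")
    case True
    have "card R < card C" using insert by simp
    then obtain c where c: "\<exists>i\<in>C. c i \<noteq> 0" "\<forall>r\<in>R. (\<Sum>i\<in>C. A r i * c i) = 0"
      using insert.IH[of C A] insert.prems by blast
    with True show ?thesis by (intro exI[of _ c]) auto
  next
    case False
    then obtain p where p: "p \<in> C" "A r p \<noteq> 0" by blast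
    \<comment> \<open>Row \<open>r\<close> is used to eliminate the unknown \<open>p\<close> from
      the other rows.\<close>
    define A' where "A' s i = A s i - A s p * A r i / A r p" for s i
    have "card R < card (C - {p})" using insert p by (simp add: card_Diff_singleton)
    then obtain c where c: "\<exists>i\<in>C-{p}. c i \<noteq> 0" "\<forall>s\<in>R. (\<Sum>i\<in>C-{p}. A' s i * c i) = 0"
      using insert.IH[of "C-{p}" A'] insert.prems by blast
    define e where "e = (\<Sum>i\<in>C-{p}. A r i * c i)"
    \<comment> \<open>Back substitution: the value at \<open>p\<close> is the one that satisfies row
      \<open>r\<close>.\<close>
    define c' where "c' = c(p := - e / A r p)"
    have split: "(\<Sum>i\<in>C. A s i * c' i) = A s p * (- e / A r p) + (\<Sum>i\<in>C-{p}. A s i * c i)" for s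
    proof -
      have "(\<Sum>i\<in>C. A s i * c' i) = A s p * c' p + (\<Sum>i\<in>C-{p}. A s i * c' i)"
        using p insert.prems by (simp add: sum.remove)
      also have "(\<Sum>i\<in>C-{p}. A s i * c' i) = (\<Sum>i\<in>C-{p}. A s i * c i)"
        by (rule sum.cong) (auto simp: c'_def)
      finally show ?thesis by (simp add: c'_def)
    qed
    have "(\<Sum>i\<in>C. A s i * c' i) = 0" if "s \<in> R" for s
    proof -
      have "0 = (\<Sum>i\<in>C-{p}. A' s i * c i)" using c that by simp
      also have "\<dots> = (\<Sum>i\<in>C-{p}. A s i * c i) - (A s p / A r p) * e"
        unfolding A'_def e_def sum_distrib_left sum_subtractf[symmetric]
        by (rule sum.cong) (auto simp: algebra_simps)
      finally show ?thesis unfolding split by (simp add: algebra_simps)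
    qed
    moreover have "(\<Sum>i\<in>C. A r i * c' i) = 0"
      unfolding split using p by (simp add: e_def)
    moreover have "\<exists>i\<in>C. c' i \<noteq> 0" using c(1) by (auto simp: c'_def)
    ultimately show ?thesis by blast
  qed
qed

text \<open>The count jumps only at values of \<open>l\<close>, so a minimum over finitely many
  candidates is a minimum over all reals. This gives the \<open>LEAST\<close> in \<open>eigv\<close>
  its meaning.\<close>

lemma finite_family_least_exceeding:
  fixes l :: "nat \<Rightarrow> real"
  assumes "n < k"
  shows "\<exists>x. n < card {i. i < k \<and> l i \<le> x} \<and> (\<forall>y. n < card {i. i < k \<and> l i \<le> y} \<longrightarrow> x \<le> y)"
proof -
  define X where "X = {x \<in> l ` {..<k}. n < card {i. i < k \<and> l i \<le> x}}"
  have fin: "finite X" by (simp add: X_def)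
  have reach: "\<exists>x\<in>X. x \<le> y" if y: "n < card {i. i < k \<and> l i \<le> y}" for y
  proof -
    define J where "J = {i. i < k \<and> l i \<le> y}"
    have J: "finite J" "J \<noteq> {}" using y by (auto simp: J_def[symmetric]) (simp add: J_def)
    \<comment> \<open>Rounding \<open>y\<close> down to the nearest value of \<open>l\<close> leaves
      the count unchanged.\<close>
    define x where "x = Max (l ` J)"
    have x: "x \<in> l ` J" "\<And>i. i \<in> J \<Longrightarrow> l i \<le> x" using J by (auto simp: x_def)
    have "{i. i < k \<and> l i \<le> x} = J" using x by (fastforce simp: J_def)
    then have "x \<in> X" using x y by (auto simp: X_def J_def)
    moreover have "x \<le> y" using x by (auto simp: J_def)
    ultimately show ?thesis by blast
  qed
  have "{i. i < k \<and> l i \<le> Max (l ` {..<k})} = {..<k}" by auto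
  then have "X \<noteq> {}" using reach[of "Max (l ` {..<k})"] assms by auto
  then have "Min X \<in> X" "\<And>x. x \<in> X \<Longrightarrow> Min X \<le> x" using fin by auto
  moreover from this(1) have "n < card {i. i < k \<and> l i \<le> Min X}" unfolding X_def by blast
  ultimately show ?thesis using reach by (meson order_trans)
qed

text \<open>The scaling is written exactly as in \<open>eig_mult\<close>, so \<open>seq.dim\<close>
  is the dimension occurring there.\<close>

global_interpretation seq: vector_space "\<lambda>(c::complex) (y::nat \<Rightarrow> complex). (\<lambda>n. c * y n)"
  by unfold_locales (auto simp: fun_eq_iff algebra_simps)

lemma sum_fun_eq: "(\<Sum>i\<in>I. F i) = (\<lambda>n. \<Sum>i\<in>I. F i n)" for F :: "'i \<Rightarrow> 'a \<Rightarrow> 'b :: comm_monoid_add"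
  by (induction I rule: infinite_finite_induct) (auto simp: fun_eq_iff)

subsection \<open>Orthonormal eigenfunctions of self-adjoint problems\<close>

locale discrete_sl =
  fixes f q w :: "nat \<Rightarrow> real" and N :: nat
  assumes N2: "2 \<le> N"
    and f_nz: "n \<le> N \<Longrightarrow> f n \<noteq> 0"
    and w_pos: "n \<in> {1..N} \<Longrightarrow> 0 < w n"
begin

definition L :: "(nat \<Rightarrow> complex) \<Rightarrow> nat \<Rightarrow> complex" where
  "L y n = - (of_real (f n) * (y (Suc n) - y n) - of_real (f (n - 1)) * (y n - y (n - 1)))
           + of_real (q n) * y n"

definition ip :: "(nat \<Rightarrow> complex) \<Rightarrow> (nat \<Rightarrow> complex) \<Rightarrow> complex" where
  "ip y z = (\<Sum>n=1..N. of_real (w n) * y n * cnj (z n))"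

text \<open>Since \<open>L y\<close> at 1 and at \<open>N\<close> involves the end values of
  \<open>y\<close>, this form depends on the boundary condition, whereas \<open>ip\<close> sees the
  interior only.\<close>

definition qf :: "(nat \<Rightarrow> complex) \<Rightarrow> (nat \<Rightarrow> complex) \<Rightarrow> complex" where
  "qf y z = (\<Sum>n=1..N. L y n * cnj (z n))"

definition adm :: "(nat \<Rightarrow> nat \<Rightarrow> complex) \<Rightarrow> (nat \<Rightarrow> complex) \<Rightarrow> bool" where
  "adm M y \<longleftrightarrow> (\<forall>n>Suc N. y n = 0) \<and> bc_holds f N M y"

abbreviation sol where "sol M lam \<equiv> sol_space f q w N M lam"

lemma sol_iff: "y \<in> sol M lam \<longleftrightarrow> adm M y \<and> (\<forall>n\<in>{1..N}. L y n = lam * of_real (w n) * y n)"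
  by (auto simp: sol_space_def sl_eq_def adm_def L_def)

lemma adm_sum:
  assumes "\<And>i. i \<in> I \<Longrightarrow> adm M (Y i)"
  shows "adm M (\<lambda>n. \<Sum>i\<in>I. c i * Y i n)"
proof -
  let ?y = "\<lambda>n. \<Sum>i\<in>I. c i * Y i n"
  have "M r 0 * ?y 0 + M r 1 * (of_real (f 0) * (?y 1 - ?y 0))
      + M r 2 * ?y N + M r 3 * (of_real (f N) * (?y (Suc N) - ?y N)) =
     (\<Sum>i\<in>I. c i * (M r 0 * Y i 0 + M r 1 * (of_real (f 0) * (Y i 1 - Y i 0))
      + M r 2 * Y i N + M r 3 * (of_real (f N) * (Y i (Suc N) - Y i N))))" for r
    by (simp add: sum_distrib_left sum_subtractf sum.distrib algebra_simps)
  moreover have "\<dots> r = 0" if "r < 2" for r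
    using assms that by (intro sum.neutral) (auto simp: adm_def bc_holds_def)
  ultimately show ?thesis using assms by (auto simp: adm_def bc_holds_def)
qed

lemma L_sum: "L (\<lambda>n. \<Sum>i\<in>I. c i * Y i n) n = (\<Sum>i\<in>I. c i * L (Y i) n)"
  by (simp add: L_def sum_distrib_left sum_subtractf sum.distrib algebra_simps)

lemma ip_sum_left: "ip (\<lambda>n. \<Sum>i\<in>I. c i * Y i n) z = (\<Sum>i\<in>I. c i * ip (Y i) z)"
  unfolding ip_def by (subst sum_distrib_left, subst sum.swap)
    (simp add: sum_distrib_left sum_distrib_right mult_ac)

lemma ip_cnj: "ip z y = cnj (ip y z)"
  by (simp add: ip_def mult_ac)

lemma ip_self: "ip y y = of_real (\<Sum>n=1..N. w n * (cmod (y n))\<^sup>2)"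
  by (simp add: ip_def mult.assoc complex_norm_square del: of_real_power)

lemma ip_self_eq_0_iff: "ip y y = 0 \<longleftrightarrow> (\<forall>n\<in>{1..N}. y n = 0)"
proof -
  have "ip y y = 0 \<longleftrightarrow> (\<Sum>n=1..N. w n * (cmod (y n))\<^sup>2) = 0"
    unfolding ip_self of_real_eq_0_iff ..
  also have "\<dots> \<longleftrightarrow> (\<forall>n\<in>{1..N}. w n * (cmod (y n))\<^sup>2 = 0)"
    by (intro sum_nonneg_eq_0_iff mult_nonneg_nonneg less_imp_le[OF w_pos]) auto
  also have "\<dots> \<longleftrightarrow> (\<forall>n\<in>{1..N}. y n = 0)"
    using w_pos by force
  finally show ?thesis .
qed

lemma ip_self_nonneg: "0 \<le> Re (ip y y)"
  unfolding ip_self Re_complex_of_real by (intro sum_nonneg mult_nonneg_nonneg less_imp_le[OF w_pos]) auto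

lemma qf_sol: "y \<in> sol M lam \<Longrightarrow> qf y z = lam * ip y z"
  unfolding qf_def ip_def sum_distrib_left by (rule sum.cong) (auto simp: sol_iff)

text \<open>With zero interior the equations at 1 and \<open>N\<close> reduce to
  \<open>f 0 * y 0 = 0\<close> and \<open>f N * y (Suc N) = 0\<close>. Hence \<open>ip\<close>, only
  semidefinite on sequences, is definite on solutions.\<close>

lemma sol_eq_0_if_interior_0:
  assumes "y \<in> sol M lam" "\<forall>n\<in>{1..N}. y n = 0"
  shows "y = 0"
proof
  fix n
  have y: "y 1 = 0" "y 2 = 0" "y N = 0" "y (N - 1) = 0" using assms(2) N2 by auto
  have "L y 1 = 0" "L y N = 0" using assms N2 by (auto simp: sol_iff)
  then have "y 0 = 0" "y (Suc N) = 0"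
    using y f_nz[of 0] f_nz[of N] by (auto simp: L_def numeral_2_eq_2)
  moreover have "y n = 0" if "n > Suc N" using assms(1) that by (auto simp: sol_iff adm_def)
  moreover have "n = 0 \<or> n \<in> {1..N} \<or> n = Suc N \<or> n > Suc N" by auto
  ultimately show "y n = 0 n" using assms(2) by auto
qed

definition orthonormal :: "nat \<Rightarrow> (nat \<Rightarrow> nat \<Rightarrow> complex) \<Rightarrow> bool" where
  "orthonormal k Y \<longleftrightarrow> (\<forall>i<k. \<forall>j<k. ip (Y i) (Y j) = (if i = j then 1 else 0))"

lemma orthogonal_family_card_le:
  assumes orth: "\<And>i j. i < k \<Longrightarrow> j < k \<Longrightarrow> i \<noteq> j \<Longrightarrow> ip (Y i) (Y j) = 0"
    and nz: "\<And>i. i < k \<Longrightarrow> ip (Y i) (Y i) \<noteq> 0"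
  shows "k \<le> N"
proof (rule ccontr)
  assume "\<not> k \<le> N"
  then have "card {1..N} < card {..<k}" by simp
  then obtain c where c: "\<exists>i\<in>{..<k}. c i \<noteq> 0" "\<forall>n\<in>{1..N}. (\<Sum>i<k. Y i n * c i) = 0"
    using homogeneous_system_nontrivial_solution[of "{1..N}" "{..<k}" "\<lambda>n i. Y i n"] by auto
  then obtain j where j: "j < k" "c j \<noteq> 0" by auto
  have "0 = ip (\<lambda>n. \<Sum>i<k. c i * Y i n) (Y j)"
    unfolding ip_def using c(2) by (intro sum.neutral[symmetric]) (auto simp: mult.commute)
  also have "\<dots> = (\<Sum>i<k. if i = j then c j * ip (Y j) (Y j) else 0)"
    unfolding ip_sum_left using orth j by (intro sum.cong) auto
  finally show False using j nz by simp
qed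

text \<open>The vector \<open>v\<close> is normal to the interior restrictions of admissible sequences: it is zero on
  the interior when the boundary condition determines the two end values, and nonzero when it
  constrains the interior values.\<close>

definition selfadjoint :: "(nat \<Rightarrow> nat \<Rightarrow> complex) \<Rightarrow> (nat \<Rightarrow> complex) \<Rightarrow> bool" where
  "selfadjoint M v \<longleftrightarrow>
     (\<forall>y z. adm M y \<longrightarrow> adm M z \<longrightarrow> qf y z = cnj (qf z y))
   \<and> (\<forall>y. adm M y \<longrightarrow> ip y v = 0)
   \<and> (\<forall>u. ip u v = 0 \<longrightarrow> (\<exists>y. adm M y \<and> (\<forall>n\<in>{1..N}. y n = u n) \<and> qf y v = 0))"

definition eigenfamily :: "(nat \<Rightarrow> nat \<Rightarrow> complex) \<Rightarrow> nat \<Rightarrow> (nat \<Rightarrow> real) \<Rightarrow> (nat \<Rightarrow> nat \<Rightarrow> complex) \<Rightarrow> bool" where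
  "eigenfamily M k l Y \<longleftrightarrow> orthonormal k Y \<and> (\<forall>i<k. Y i \<in> sol M (of_real (l i)))"

lemma eigenvalue_real:
  assumes "selfadjoint M v" "y \<in> sol M lam" "y \<noteq> 0"
  shows "lam = of_real (Re lam)"
proof -
  have nz: "ip y y \<noteq> 0" using assms sol_eq_0_if_interior_0 ip_self_eq_0_iff by blast
  have "lam * ip y y = cnj (lam * ip y y)"
    using assms qf_sol[OF assms(2), of y] by (metis selfadjoint_def sol_iff)
  also have "\<dots> = cnj lam * ip y y" using ip_cnj[of y y] by simp
  finally have "cnj lam = lam" using nz by auto
  then show ?thesis by (simp add: complex_eq_iff)
qed

text \<open>A polynomial \<open>p\<close> of least degree annihilating \<open>Z\<close> factors as \<open>(X - lam) * r\<close>, and \<open>r\<close> applied to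
  \<open>Z\<close> is an eigenfunction for \<open>lam\<close>.\<close>

lemma krylov_sequence_eigenfunction:
  assumes adm: "\<And>j. adm M (Z j)"
    and step: "\<And>j n. n \<in> {1..N} \<Longrightarrow> L (Z j) n = of_real (w n) * Z (Suc j) n"
    and nz: "\<exists>n\<in>{1..N}. Z 0 n \<noteq> 0"
  shows "\<exists>lam m c. (\<lambda>n. \<Sum>j\<le>m. c j * Z j n) \<in> sol M lam \<and> (\<exists>n\<in>{1..N}. (\<Sum>j\<le>(m::nat). c j * Z j n) \<noteq> 0)"
proof -
  \<comment> \<open>With \<open>Z j\<close> in the role of the j-th power of an operator applied to
    \<open>Z 0\<close>, this says that \<open>p\<close> of the operator kills \<open>Z 0\<close> on
    the interior.\<close>
  define P where "P p \<longleftrightarrow> p \<noteq> 0 \<and> (\<forall>n\<in>{1..N}. (\<Sum>j\<le>degree p. coeff p j * Z j n) = 0)" for p :: "complex poly"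
  have ext: "(\<Sum>j\<le>degree p. coeff p j * Z j n) = (\<Sum>j\<le>m. coeff p j * Z j n)" if "degree p \<le> m" for p m n
    using that by (intro sum.mono_neutral_left) (auto intro: coeff_eq_0)
  have "\<exists>p. P p"
  proof -
    \<comment> \<open>The \<open>N + 1\<close> vectors \<open>Z 0, ..., Z N\<close> have only
      \<open>N\<close> interior coordinates, so they are dependent there.\<close>
    obtain c where c: "\<exists>i\<in>{..N}. c i \<noteq> 0" "\<forall>n\<in>{1..N}. (\<Sum>i\<le>N. Z i n * c i) = 0"
      using homogeneous_system_nontrivial_solution[of "{1..N}" "{..N}" "\<lambda>n i. Z i n"] by auto
    define p where "p = (\<Sum>i\<le>N. monom (c i) i)"
    have co: "coeff p j = (if j \<le> N then c j else 0)" for j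
      by (auto simp: p_def coeff_sum)
    have "degree p \<le> N" using co by (intro degree_le) auto
    moreover have "p \<noteq> 0" using c(1) co by (metis atMost_iff coeff_0)
    ultimately have "P p" unfolding P_def using c(2) by (subst ext[of p N]) (simp_all add: co mult.commute)
    then show ?thesis by blast
  qed
  then obtain p where p: "P p" and pmin: "\<And>r. P r \<Longrightarrow> degree p \<le> degree r"
    using ex_has_least_nat[of P _ degree] by blast
  have "degree p \<noteq> 0"
  proof
    assume "degree p = 0"
    then obtain a where "p = [:a:]" using degree_eq_zeroE by blast
    then show False using p nz by (auto simp: P_def)
  qed
  then have "\<not> constant (poly p)" by (simp add: constant_degree)
  then obtain lam where "poly p lam = 0" using fundamental_theorem_of_algebra by blast
  then obtain r where r: "p = [:- lam, 1:] * r" by (metis poly_eq_0_iff_dvd dvdE)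
  have r0: "r \<noteq> 0" using p r by (auto simp: P_def)
  have dp: "degree p = Suc (degree r)" unfolding r using r0 by (subst degree_mult_eq) auto
  then have "\<not> P r" using pmin[of r] by auto
  then have rnz: "\<exists>n\<in>{1..N}. (\<Sum>j\<le>degree r. coeff r j * Z j n) \<noteq> 0" using r0 by (auto simp: P_def)
  let ?z = "\<lambda>n. \<Sum>j\<le>degree r. coeff r j * Z j n"
  have "L ?z n = lam * of_real (w n) * ?z n" if n: "n \<in> {1..N}" for n
  proof -
    have "0 = (\<Sum>j\<le>Suc (degree r). coeff p j * Z j n)" using p n dp by (simp add: P_def)
    \<comment> \<open>The product \<open>(X - lam) * r\<close> is split; \<open>pCons 0 r\<close> is
      \<open>X * r\<close>, whose shifted coefficients turn \<open>Z j\<close> into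
      \<open>Z (Suc j)\<close>.\<close>
    also have "\<dots> = (\<Sum>j\<le>Suc (degree r). coeff (pCons 0 r) j * Z j n) - lam * (\<Sum>j\<le>Suc (degree r). coeff r j * Z j n)"
      unfolding r sum_distrib_left sum_subtractf[symmetric] by (intro sum.cong) (auto simp: algebra_simps)
    also have "(\<Sum>j\<le>Suc (degree r). coeff (pCons 0 r) j * Z j n) = (\<Sum>j\<le>degree r. coeff r j * Z (Suc j) n)"
      by (subst sum.atMost_Suc_shift) simp
    also have "(\<Sum>j\<le>Suc (degree r). coeff r j * Z j n) = ?z n" by (rule ext[symmetric]) simp
    finally have "(\<Sum>j\<le>degree r. coeff r j * Z (Suc j) n) = lam * ?z n" by simp
    moreover have "L ?z n = of_real (w n) * (\<Sum>j\<le>degree r. coeff r j * Z (Suc j) n)"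
      unfolding L_sum sum_distrib_left by (intro sum.cong) (auto simp: step[OF n])
    ultimately show ?thesis by simp
  qed
  moreover have "adm M ?z" by (rule adm_sum) (rule adm)
  ultimately have "?z \<in> sol M lam" by (simp add: sol_iff)
  then show ?thesis using rnz by blast
qed

lemma sol_scale: "y \<in> sol M lam \<Longrightarrow> (\<lambda>n. c * y n) \<in> sol M lam"
  using adm_sum[of "{()}" M "\<lambda>_. y" "\<lambda>_. c"] L_sum[of "\<lambda>_. c" "\<lambda>_. y" "{()}"]
  by (auto simp: sol_iff)

lemma eigenfamily_extend:
  assumes fam: "eigenfamily M k l Y" and y: "y \<in> sol M (of_real t)" "ip y y \<noteq> 0"
    and orth: "\<And>i. i < k \<Longrightarrow> ip y (Y i) = 0"
  shows "\<exists>l' Y'. eigenfamily M (Suc k) l' Y'"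
proof -
  define s where "s = sqrt (Re (ip y y))"
  define z where "z = (\<lambda>n. of_real (1 / s) * y n)"
  have re: "ip y y = of_real (Re (ip y y))" using ip_self[of y] by simp
  have "Re (ip y y) > 0" using ip_self_nonneg[of y] re y(2) by (metis less_eq_real_def of_real_0)
  then have s: "s > 0" "s * s = Re (ip y y)" by (auto simp: s_def)
  have "ip z z = of_real (1 / s) * of_real (1 / s) * ip y y"
    by (simp add: z_def ip_def sum_distrib_left sum_divide_distrib mult_ac)
  also have "\<dots> = of_real (1 / s * (1 / s) * (s * s))"
    unfolding s(2) by (subst re) (simp only: of_real_mult)
  also have "\<dots> = 1" using s(1) by simp
  finally have zz: "ip z z = 1" .
  have zY: "ip z (Y i) = 0" "ip (Y i) z = 0" if "i < k" for i
  proof -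
    show "ip z (Y i) = 0" using ip_sum_left[of "\<lambda>_. of_real (1/s)" "\<lambda>_. y" "{()}"] orth[OF that] by (simp add: z_def)
    then show "ip (Y i) z = 0" using ip_cnj[of "Y i" z] by simp
  qed
  have "orthonormal (Suc k) (Y(k := z))" using fam zz zY by (auto simp: orthonormal_def eigenfamily_def less_Suc_eq)
  moreover have "z \<in> sol M (of_real t)" unfolding z_def by (rule sol_scale) fact
  ultimately have "eigenfamily M (Suc k) (l(k := t)) (Y(k := z))"
    using fam by (auto simp: eigenfamily_def less_Suc_eq)
  then show ?thesis by blast
qed

text \<open>By symmetry \<open>qf z y\<close> is \<open>t * ip z y\<close>. Thus the orthogonal
  complement of an eigenfunction is invariant, which keeps Krylov sequences orthogonal to the
  eigenfunctions already found.\<close>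

lemma ip_orthogonal_eigen_step:
  assumes sa: "selfadjoint M v" and y: "y \<in> sol M (of_real t)" and z: "adm M z" and orth: "ip z y = 0"
  shows "qf z y = 0"
proof -
  have "qf z y = cnj (qf y z)" using sa y z unfolding selfadjoint_def sol_iff by blast
  also have "\<dots> = cnj (of_real t * ip y z)" using qf_sol[OF y] by simp
  also have "\<dots> = of_real t * ip z y" using ip_cnj[of z y] by simp
  finally show ?thesis using orth by simp
qed

text \<open>The room left by \<open>k + d < N\<close> contains a nonzero interior vector orthogonal
  to \<open>v\<close> and to all \<open>Y i\<close>. Repeatedly forming \<open>L z / w\<close> and
  lifting it back to an admissible sequence stays in this complement, so the Krylov sequence yields
  an eigenfunction there.\<close>

lemma eigenfamily_not_maximal:
  assumes sa: "selfadjoint M v" and fam: "eigenfamily M k l Y"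
    and d: "d = (if ip v v = 0 then 0 else 1)" and k: "k + d < N"
  shows "\<exists>l' Y'. eigenfamily M (Suc k) l' Y'"
proof -
  \<comment> \<open>For \<open>d = 1\<close> the index \<open>k\<close> adds orthogonality to
    \<open>v\<close> to the system; for \<open>d = 0\<close> the indices stop before
    \<open>k\<close>.\<close>
  define Y' where "Y' = Y(k := v)"
  obtain u where u: "\<exists>n\<in>{1..N}. u n \<noteq> 0" "\<forall>r\<in>{..<k+d}. (\<Sum>n=1..N. of_real (w n) * cnj (Y' r n) * u n) = 0"
    using homogeneous_system_nontrivial_solution[of "{..<k+d}" "{1..N}" "\<lambda>r n. of_real (w n) * cnj (Y' r n)"] k by auto
  have u': "ip u (Y' r) = 0" if "r < k + d" for r
    using u(2) that by (auto simp: ip_def mult_ac)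
  have uY: "ip u (Y i) = 0" if "i < k" for i using u'[of i] that by (auto simp: Y'_def)
  have uv: "ip u v = 0"
  proof (cases "ip v v = 0")
    case True
    then show ?thesis using ip_self_eq_0_iff[of v] by (auto simp: ip_def)
  next
    case False
    then show ?thesis using u'[of k] d by (auto simp: Y'_def)
  qed
  \<comment> \<open>The clause \<open>qf z v = 0\<close> makes \<open>L z / w\<close> orthogonal to
    \<open>v\<close>, so that it can be lifted again.\<close>
  define P where "P z \<longleftrightarrow> adm M z \<and> qf z v = 0 \<and> (\<forall>i<k. ip z (Y i) = 0)" for z
  have lift: "\<exists>z. adm M z \<and> (\<forall>n\<in>{1..N}. z n = x n) \<and> qf z v = 0" if "ip x v = 0" for x
    using sa that unfolding selfadjoint_def by blast
  obtain z0 where z0: "adm M z0" "\<forall>n\<in>{1..N}. z0 n = u n" "qf z0 v = 0" using lift[OF uv] by blast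
  have "P z0" using z0 uY by (auto simp: P_def ip_def)
  moreover have "\<exists>z'. P z' \<and> (\<forall>n\<in>{1..N}. L z n = of_real (w n) * z' n)" if z: "P z" for z
  proof -
    define x where "x n = L z n / of_real (w n)" for n
    have wx: "of_real (w n) * x n = L z n" if "n \<in> {1..N}" for n
      using w_pos[OF that] by (simp add: x_def)
    have xq: "ip x y = qf z y" for y
      unfolding ip_def qf_def by (rule sum.cong) (simp_all only: wx)
    then have "ip x v = 0" using z by (simp add: P_def)
    from lift[OF this] obtain z' where z': "adm M z'" "\<forall>n\<in>{1..N}. z' n = x n" "qf z' v = 0" by blast
    have "ip z' (Y i) = 0" if "i < k" for i
    proof -
      have "ip z' (Y i) = qf z (Y i)" using z' xq by (simp add: ip_def)
      also have "\<dots> = 0" using ip_orthogonal_eigen_step[OF sa] z fam that by (auto simp: P_def eigenfamily_def)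
      finally show ?thesis .
    qed
    then show ?thesis using z' wx by (auto simp: P_def)
  qed
  ultimately obtain Z where Z: "\<And>j. P (Z j)" "Z 0 = z0"
    "\<And>j n. n \<in> {1..N} \<Longrightarrow> L (Z j) n = of_real (w n) * Z (Suc j) n"
  proof -
    assume a1: "P z0" and a2: "\<And>z. P z \<Longrightarrow> \<exists>z'. P z' \<and> (\<forall>n\<in>{1..N}. L z n = of_real (w n) * z' n)"
    have "\<exists>Z. \<forall>j. (P (Z j) \<and> (j = 0 \<longrightarrow> Z j = z0)) \<and> (\<forall>n\<in>{1..N}. L (Z j) n = of_real (w n) * Z (Suc j) n)"
      by (rule dependent_nat_choice) (use a1 a2 in auto)
    then show thesis using that by blast
  qed
  have nz: "\<exists>n\<in>{1..N}. Z 0 n \<noteq> 0" using u z0 Z(2) by auto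
  obtain lam m c where lam: "(\<lambda>n. \<Sum>j\<le>m. c j * Z j n) \<in> sol M lam" "\<exists>n\<in>{1..N}. (\<Sum>j\<le>(m::nat). c j * Z j n) \<noteq> 0"
    using krylov_sequence_eigenfunction[of M Z, OF _ Z(3) nz] Z(1) unfolding P_def by blast
  define y where "y = (\<lambda>n. \<Sum>j\<le>m. c j * Z j n)"
  have y: "y \<in> sol M lam" "ip y y \<noteq> 0" using lam by (auto simp: y_def ip_self_eq_0_iff)
  have "y \<noteq> 0" using lam(2) by (auto simp: y_def fun_eq_iff)
  then have "lam = of_real (Re lam)" using eigenvalue_real[OF sa y(1)] by blast
  with y(1) have "y \<in> sol M (of_real (Re lam))" by simp
  moreover have "ip y (Y i) = 0" if "i < k" for i
    unfolding y_def ip_sum_left using Z(1) that by (simp add: P_def)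
  ultimately show ?thesis by (rule eigenfamily_extend[OF fam _ y(2)])
qed

text \<open>A longest family has length \<open>N - d\<close>: a shorter one could be extended, and a
  longer one together with \<open>v\<close> would exceed the \<open>N\<close> interior dimensions.
  Maximality is kept in the conclusion because the expansion of eigenfunctions rests on it.\<close>

lemma complete_eigenfamily_exists:
  assumes sa: "selfadjoint M v" and d: "d = (if ip v v = 0 then 0 else 1)"
  shows "\<exists>l Y. eigenfamily M (N - d) l Y \<and> (\<nexists>l' Y'. eigenfamily M (Suc (N - d)) l' Y')"
proof -
  define P where "P k \<longleftrightarrow> (\<exists>l Y. eigenfamily M k l Y)" for k
  have bound: "k + d \<le> N" if "P k" for k
  proof -
    obtain l Y where fam: "eigenfamily M k l Y" using \<open>P k\<close> by (auto simp: P_def)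
    define Y' where "Y' = Y(k := v)"
    have "ip (Y i) v = 0" if "i < k" for i
      using fam sa that unfolding eigenfamily_def selfadjoint_def sol_iff by blast
    moreover have "ip v (Y i) = 0" if "i < k" for i
      using calculation[OF that] ip_cnj[of v "Y i"] by simp
    ultimately show ?thesis
      using fam d by (intro orthogonal_family_card_le[of "k + d" Y'])
        (auto simp: Y'_def eigenfamily_def orthonormal_def less_Suc_eq split: if_splits)
  qed
  have "P 0" by (auto simp: P_def eigenfamily_def orthonormal_def)
  moreover have bd: "k \<le> N" if "P k" for k using bound[OF that] by simp
  ultimately have G: "P (Greatest P)" "\<And>k. P k \<Longrightarrow> k \<le> Greatest P"
    using GreatestI_nat[of P 0 N] Greatest_le_nat[of P _ N] by auto
  have "\<not> Greatest P + d < N"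
  proof
    assume "Greatest P + d < N"
    then have "P (Suc (Greatest P))" using G(1) eigenfamily_not_maximal[OF sa _ d] unfolding P_def by blast
    then show False using G(2) by fastforce
  qed
  then have "Greatest P = N - d" using bound[OF G(1)] by simp
  then have "P (N - d)" "\<not> P (Suc (N - d))" using G by fastforce+
  then show ?thesis by (auto simp: P_def)
qed


section \<open>Multiplicities as counts of indices\<close>

lemma L_diff: "L (\<lambda>n. y n - z n) n = L y n - L z n"
  by (simp add: L_def algebra_simps)

lemma sol_diff: "y \<in> sol M lam \<Longrightarrow> z \<in> sol M lam \<Longrightarrow> (\<lambda>n. y n - z n) \<in> sol M lam"
  using adm_sum[of UNIV M "\<lambda>b. if b then y else z" "\<lambda>b. if b then 1 else - 1"]
  by (simp add: sol_iff UNIV_bool L_diff right_diff_distrib)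

lemma sol_sum:
  assumes "\<And>i. i \<in> I \<Longrightarrow> Y i \<in> sol M lam"
  shows "(\<lambda>n. \<Sum>i\<in>I. c i * Y i n) \<in> sol M lam"
  using assms adm_sum[of I M Y c]
  by (auto simp: sol_iff L_sum sum_distrib_left algebra_simps intro!: sum.cong)

lemma eigenfunctions_orthogonal:
  assumes sa: "selfadjoint M v" and y: "y \<in> sol M (of_real s)" and z: "z \<in> sol M (of_real t)" and "s \<noteq> t"
  shows "ip y z = 0"
proof -
  have "of_real s * ip y z = qf y z" using qf_sol[OF y] by simp
  also have "\<dots> = cnj (qf z y)" using sa y z unfolding selfadjoint_def sol_iff by blast
  also have "\<dots> = of_real t * ip y z" using qf_sol[OF z] ip_cnj[of y z] by simp
  finally show ?thesis using \<open>s \<noteq> t\<close> by simp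
qed

text \<open>The difference of \<open>y\<close> and its projection is a solution for \<open>t\<close>
  orthogonal to the whole family; were it nonzero, it would extend the family.\<close>

lemma eigenfunction_expansion:
  assumes sa: "selfadjoint M v" and fam: "eigenfamily M k l Y"
    and max: "\<nexists>l' Y'. eigenfamily M (Suc k) l' Y'" and y: "y \<in> sol M (of_real t)"
  shows "y = (\<lambda>n. \<Sum>i | i < k \<and> l i = t. ip y (Y i) * Y i n)"
proof -
  define I where "I = {i. i < k \<and> l i = t}"
  define s where "s = (\<lambda>n. \<Sum>i\<in>I. ip y (Y i) * Y i n)"
  define z where "z = (\<lambda>n. y n - s n)"
  have "s \<in> sol M (of_real t)"
    unfolding s_def by (rule sol_sum) (use fam in \<open>auto simp: I_def eigenfamily_def\<close>)
  then have z: "z \<in> sol M (of_real t)" unfolding z_def by (rule sol_diff[OF y])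
  have "ip z (Y j) = 0" if j: "j < k" for j
  proof (cases "l j = t")
    case True
    have "ip s (Y j) = (\<Sum>i\<in>I. if i = j then ip y (Y j) else 0)"
      unfolding s_def ip_sum_left using fam j
      by (intro sum.cong) (auto simp: I_def eigenfamily_def orthonormal_def)
    also have "\<dots> = ip y (Y j)" using True j by (simp add: I_def)
    finally show ?thesis by (simp add: z_def ip_def algebra_simps sum_subtractf)
  next
    case False
    have "Y j \<in> sol M (of_real (l j))" using fam j by (auto simp: eigenfamily_def)
    with False show ?thesis using eigenfunctions_orthogonal[OF sa z] by metis
  qed
  then have "ip z z = 0" using max eigenfamily_extend[OF fam z] by blast
  then have "z = 0" using sol_eq_0_if_interior_0[OF z] by (simp add: ip_self_eq_0_iff)
  then have "y = s" by (auto simp: z_def fun_eq_iff)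
  then show ?thesis by (simp add: s_def I_def)
qed

text \<open>The \<open>Y i\<close> with \<open>l i = t\<close> form a basis of the solution space:
  orthonormality gives independence, the expansion gives spanning.\<close>

lemma eig_mult_eq_card:
  assumes sa: "selfadjoint M v" and fam: "eigenfamily M k l Y"
    and max: "\<nexists>l' Y'. eigenfamily M (Suc k) l' Y'"
  shows "eig_mult f q w N M (of_real t) = card {i. i < k \<and> l i = t}"
proof -
  define I where "I = {i. i < k \<and> l i = t}"
  have fin: "finite I" by (simp add: I_def)
  have on: "ip (Y i) (Y j) = (if i = j then 1 else 0)" if "i \<in> I" "j \<in> I" for i j
    using fam that by (auto simp: I_def eigenfamily_def orthonormal_def)
  have inj: "inj_on Y I"
  proof (rule inj_onI)
    fix i j assume "i \<in> I" "j \<in> I" "Y i = Y j"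
    then show "i = j" using on[of i j] on[of j j] by (auto split: if_splits)
  qed
  have "seq.independent (Y ` I)"
  proof (rule ccontr)
    assume "\<not> seq.independent (Y ` I)"
    then obtain c where c: "\<exists>y\<in>Y ` I. c y \<noteq> 0" "(\<Sum>y\<in>Y ` I. (\<lambda>n. c y * y n)) = 0"
      using fin by (auto simp: seq.dependent_finite)
    then obtain j where j: "j \<in> I" "c (Y j) \<noteq> 0" by auto
    have "(\<lambda>n. \<Sum>i\<in>I. c (Y i) * Y i n) = 0"
      using c(2) inj by (simp add: sum.reindex sum_fun_eq)
    then have "0 = ip (\<lambda>n. \<Sum>i\<in>I. c (Y i) * Y i n) (Y j)" by (simp add: ip_def)
    also have "\<dots> = (\<Sum>i\<in>I. if i = j then c (Y j) else 0)"
      unfolding ip_sum_left using on j by (intro sum.cong) auto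
    also have "\<dots> = c (Y j)" using fin j by simp
    finally show False using j by simp
  qed
  moreover have "seq.span (Y ` I) = seq.span (sol M (of_real t))"
  proof (rule seq.span_eq[THEN iffD2], intro conjI subsetI)
    fix y assume "y \<in> Y ` I"
    then have "y \<in> sol M (of_real t)" using fam by (auto simp: I_def eigenfamily_def)
    then show "y \<in> seq.span (sol M (of_real t))" by (rule seq.span_base)
  next
    fix y assume "y \<in> sol M (of_real t)"
    then have "y = (\<Sum>i\<in>I. (\<lambda>n. ip y (Y i) * Y i n))"
      unfolding I_def sum_fun_eq by (rule eigenfunction_expansion[OF sa fam max])
    also have "\<dots> \<in> seq.span (Y ` I)"
      by (intro seq.span_sum seq.span_scale seq.span_base) auto
    finally show "y \<in> seq.span (Y ` I)" .
  qed
  ultimately have "seq.dim (sol M (of_real t)) = card (Y ` I)" by (intro seq.dim_eq_card) auto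
  then show ?thesis using inj by (simp add: eig_mult_def card_image I_def)
qed

lemma is_eig_iff:
  assumes sa: "selfadjoint M v" and fam: "eigenfamily M k l Y"
    and max: "\<nexists>l' Y'. eigenfamily M (Suc k) l' Y'"
  shows "is_eig f q w N M lam \<longleftrightarrow> (\<exists>i<k. lam = of_real (l i))"
proof
  assume "is_eig f q w N M lam"
  then obtain y where y: "y \<in> sol M lam" "y \<noteq> 0" by (auto simp: is_eig_def)
  then have lam: "lam = of_real (Re lam)" using eigenvalue_real[OF sa] by blast
  have "y \<in> sol M (of_real (Re lam))" unfolding lam[symmetric] by (rule y(1))
  note expansion = eigenfunction_expansion[OF sa fam max this]
  have "{i. i < k \<and> l i = Re lam} \<noteq> {}"
  proof
    assume "{i. i < k \<and> l i = Re lam} = {}"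
    with expansion have "y = (\<lambda>n. 0)" by (simp only: sum.empty)
    with y(2) show False by (simp add: zero_fun_def)
  qed
  then show "\<exists>i<k. lam = of_real (l i)" using lam by auto
next
  assume "\<exists>i<k. lam = of_real (l i)"
  then obtain i where i: "i < k" "lam = of_real (l i)" by blast
  then have "Y i \<in> sol M lam" "ip (Y i) (Y i) = 1" using fam by (auto simp: eigenfamily_def orthonormal_def)
  moreover from this(2) have "Y i \<noteq> 0" by (auto simp: ip_def)
  ultimately show "is_eig f q w N M lam" by (auto simp: is_eig_def)
qed

text \<open>All that the comparison needs: sums of multiplicities become counts of indices, and
  \<open>eigv\<close> is read off a counting function, with no ordering of \<open>l\<close>
  required.\<close>

lemma spectral_data:
  assumes sa: "selfadjoint M v" and d: "d = (if ip v v = 0 then 0 else 1)"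
  shows "\<exists>l Y. eigenfamily M (N - d) l Y \<and> has_eigs f q w N M (N - d)
     \<and> (\<forall>n. eigv f q w N M n = (LEAST x. n < card {i. i < N - d \<and> l i \<le> x}))"
proof -
  define k where "k = N - d"
  obtain l Y where fam: "eigenfamily M k l Y" and max: "\<nexists>l' Y'. eigenfamily M (Suc k) l' Y'"
    using complete_eigenfamily_exists[OF sa d] unfolding k_def by blast
  note mult = eig_mult_eq_card[OF sa fam max] and eig = is_eig_iff[OF sa fam max]
  \<comment> \<open>An index set closed under equal \<open>l\<close> is partitioned into full fibres
    of \<open>l\<close>, whose sizes are the multiplicities.\<close>
  have count: "(\<Sum>t\<in>l ` I. card {i. i < k \<and> l i = t}) = card I"
    if I: "finite I" "\<And>i j. i \<in> I \<Longrightarrow> j < k \<Longrightarrow> l j = l i \<Longrightarrow> j \<in> I" "I \<subseteq> {..<k}" for I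
  proof -
    have "card I = (\<Sum>t\<in>l ` I. card {i \<in> I. l i = t})"
      using sum.image_gen[OF I(1), of "\<lambda>_. 1::nat" l] by simp
    also have "\<dots> = (\<Sum>t\<in>l ` I. card {i. i < k \<and> l i = t})"
    proof (rule sum.cong)
      fix t assume "t \<in> l ` I"
      then have "{i \<in> I. l i = t} = {i. i < k \<and> l i = t}" using I by auto
      then show "card {i \<in> I. l i = t} = card {i. i < k \<and> l i = t}" by simp
    qed simp
    finally show ?thesis by simp
  qed
  have set: "{lam. is_eig f q w N M lam} = complex_of_real ` l ` {..<k}" by (auto simp: eig)
  have "(\<Sum>lam\<in>{lam. is_eig f q w N M lam}. eig_mult f q w N M lam)
      = (\<Sum>t\<in>l ` {..<k}. card {i. i < k \<and> l i = t})"
    unfolding set by (subst sum.reindex) (auto simp: inj_on_def mult)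
  also have "\<dots> = k" using count[of "{..<k}"] by auto
  finally have "has_eigs f q w N M k" unfolding has_eigs_def by (simp add: set)
  moreover have "eigv f q w N M n = (LEAST x. n < card {i. i < k \<and> l i \<le> x})" for n
  proof -
    have "{t. is_eig f q w N M (of_real t) \<and> t \<le> x} = l ` {i. i < k \<and> l i \<le> x}" for x
      by (auto simp: eig)
    moreover have "(\<Sum>t\<in>l ` {i. i < k \<and> l i \<le> x}. card {i. i < k \<and> l i = t}) = card {i. i < k \<and> l i \<le> x}" for x
      by (rule count) auto
    ultimately show ?thesis by (simp add: eigv_def mult)
  qed
  ultimately show ?thesis using fam unfolding k_def by blast
qed

subsection \<open>Comparison of two problems\<close>

text \<open>An orthonormal eigenfamily diagonalises both forms (Parseval).\<close>

lemma eigenfamily_combination: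
  assumes fam: "eigenfamily M k l Y" and I: "I \<subseteq> {..<k}" and z: "z = (\<lambda>n. \<Sum>i\<in>I. c i * Y i n)"
  shows "adm M z" "Re (ip z z) = (\<Sum>i\<in>I. (cmod (c i))\<^sup>2)"
    "Re (qf z z) = (\<Sum>i\<in>I. l i * (cmod (c i))\<^sup>2)"
proof -
  have fin: "finite I" using I finite_subset by blast
  have Y: "Y i \<in> sol M (of_real (l i))" if "i \<in> I" for i using fam I that by (auto simp: eigenfamily_def)
  show "adm M z" unfolding z by (rule adm_sum) (use Y in \<open>auto simp: sol_iff\<close>)
  have Yz: "ip (Y i) z = cnj (c i)" if i: "i \<in> I" for i
  proof -
    have "ip z (Y i) = (\<Sum>j\<in>I. if j = i then c i else 0)"
      unfolding z ip_sum_left using fam i I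
      by (intro sum.cong) (auto simp: eigenfamily_def orthonormal_def subset_iff)
    also have "\<dots> = c i" using i fin by simp
    finally show ?thesis using ip_cnj[of "Y i" z] by simp
  qed
  have "ip z z = (\<Sum>i\<in>I. c i * ip (Y i) z)" using ip_sum_left[of c Y I z] z by simp
  also have "\<dots> = (\<Sum>i\<in>I. of_real ((cmod (c i))\<^sup>2))"
    by (rule sum.cong) (auto simp: Yz complex_norm_square simp del: of_real_power)
  finally show "Re (ip z z) = (\<Sum>i\<in>I. (cmod (c i))\<^sup>2)" by simp
  have "qf z z = (\<Sum>n=1..N. (\<Sum>i\<in>I. c i * L (Y i) n) * cnj (z n))"
    unfolding qf_def using L_sum[of c Y I] z by simp
  also have "\<dots> = (\<Sum>i\<in>I. c i * qf (Y i) z)"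
    unfolding qf_def sum_distrib_left sum_distrib_right by (subst sum.swap) (simp add: mult_ac)
  also have "\<dots> = (\<Sum>i\<in>I. of_real (l i * (cmod (c i))\<^sup>2))"
    by (rule sum.cong) (auto simp: qf_sol[OF Y] Yz complex_norm_square simp del: of_real_power)
  finally show "Re (qf z z) = (\<Sum>i\<in>I. l i * (cmod (c i))\<^sup>2)" by simp
qed

text \<open>If the counting inequality failed, the span of the low eigenfunctions of \<open>B\<close> would meet the
  span of the high eigenfunctions of \<open>A\<close> in a nonzero interior vector, on which the form of \<open>A\<close>
  exceeds that of \<open>B\<close>. For \<open>j = 1\<close> the comparison of forms is needed only on the kernel of
  \<open>\<phi>A + \<phi>B\<close>, at the price of one dimension.\<close>

lemma eigenvalue_count_comparison:
  assumes A: "eigenfamily A kA lA YA" and B: "eigenfamily B kB lB YB" and j: "j \<le> 1"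
    and linA: "\<And>I c. \<phi>A (\<lambda>n. \<Sum>i\<in>I. c i * YA i n) = (\<Sum>i\<in>I. c i * \<phi>A (YA i))"
    and linB: "\<And>I c. \<phi>B (\<lambda>n. \<Sum>i\<in>I. c i * YB i n) = (\<Sum>i\<in>I. c i * \<phi>B (YB i))"
    and cmp: "\<And>y z. adm A y \<Longrightarrow> adm B z \<Longrightarrow> (\<forall>n\<in>{1..N}. y n = z n) \<Longrightarrow> (j = 1 \<Longrightarrow> \<phi>A y + \<phi>B z = 0)
        \<Longrightarrow> Re (qf y y) \<le> Re (qf z z)"
  shows "card {i. i < kB \<and> lB i \<le> x} + kA \<le> card {i. i < kA \<and> lA i \<le> x} + N + j"
proof (rule ccontr)
  assume neg: "\<not> ?thesis"
  define I where "I = {i. i < kB \<and> lB i \<le> x}"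
  define J where "J = {i. i < kA \<and> x < lA i}"
  have fin: "finite I" "finite J" by (auto simp: I_def J_def)
  have "card J = kA - card {i. i < kA \<and> lA i \<le> x}"
  proof -
    have "J = {..<kA} - {i. i < kA \<and> lA i \<le> x}" by (auto simp: J_def)
    then show ?thesis by (simp add: card_Diff_subset subset_iff)
  qed
  then have big: "N + j < card I + card J" using neg by (simp add: I_def)
  define C where "C = I <+> J"
  \<comment> \<open>Rows \<open>1..N\<close> express \<open>y = z\<close> on the interior, with the
    sign on the side of \<open>B\<close>. Row 0 does not stand for a coordinate but for the
    constraint \<open>\<phi>A y + \<phi>B z = 0\<close>.\<close>
  define E where "E = (\<lambda>n. case_sum
      (\<lambda>i. if n = 0 then \<phi>B (YB i) else - YB i n) (\<lambda>i. if n = 0 then \<phi>A (YA i) else YA i n))"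
  have Csum: "(\<Sum>i\<in>C. g i) = (\<Sum>i\<in>I. g (Inl i)) + (\<Sum>i\<in>J. g (Inr i))" for g :: "nat + nat \<Rightarrow> complex"
    unfolding C_def using fin by (simp add: sum.Plus)
  \<comment> \<open>The range \<open>{1 - j..N}\<close> includes row 0 exactly when
    \<open>j = 1\<close>.\<close>
  have "card {1 - j..N} < card C" using big j fin by (simp add: C_def card_Plus)
  then obtain c where c: "\<exists>i\<in>C. c i \<noteq> 0" "\<forall>n\<in>{1 - j..N}. (\<Sum>i\<in>C. E n i * c i) = 0"
    using homogeneous_system_nontrivial_solution[of "{1 - j..N}" C E] fin by (auto simp: C_def)
  define z where "z = (\<lambda>n. \<Sum>i\<in>I. c (Inl i) * YB i n)"
  define y where "y = (\<lambda>n. \<Sum>i\<in>J. c (Inr i) * YA i n)"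
  have eq: "\<forall>n\<in>{1..N}. y n = z n"
  proof
    fix n assume n: "n \<in> {1..N}"
    then have "(\<Sum>i\<in>C. E n i * c i) = 0" using c(2) by auto
    then show "y n = z n" using n by (simp add: Csum E_def y_def z_def sum_negf mult.commute)
  qed
  have con: "\<phi>A y + \<phi>B z = 0" if "j = 1"
  proof -
    have "(\<Sum>i\<in>C. E 0 i * c i) = 0" using c(2) that by auto
    then show ?thesis unfolding y_def z_def linA linB by (simp add: Csum E_def mult.commute add.commute)
  qed
  have Isub: "I \<subseteq> {..<kB}" and Jsub: "J \<subseteq> {..<kA}" by (auto simp: I_def J_def)
  note Z = eigenfamily_combination[OF B Isub z_def] and Y = eigenfamily_combination[OF A Jsub y_def]
  have le: "Re (qf y y) \<le> Re (qf z z)" by (rule cmp) (use Y(1) Z(1) eq con in auto)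
  have same: "(\<Sum>i\<in>J. (cmod (c (Inr i)))\<^sup>2) = (\<Sum>i\<in>I. (cmod (c (Inl i)))\<^sup>2)"
    unfolding Y(2)[symmetric] Z(2)[symmetric] using eq by (simp add: ip_def)
  \<comment> \<open>Both sides have the same norm, so if the coefficients over \<open>J\<close>
    vanished, those over \<open>I\<close> would too.\<close>
  have "\<exists>i\<in>J. c (Inr i) \<noteq> 0"
  proof (rule ccontr)
    assume no: "\<not> ?thesis"
    then have "(\<Sum>i\<in>I. (cmod (c (Inl i)))\<^sup>2) = 0" unfolding same[symmetric] by simp
    then have "\<forall>i\<in>I. c (Inl i) = 0" using fin by (simp add: sum_nonneg_eq_0_iff)
    with no c(1) show False by (auto simp: C_def)
  qed
  then obtain i0 where i0: "i0 \<in> J" "c (Inr i0) \<noteq> 0" by blast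
  have "x * (\<Sum>i\<in>J. (cmod (c (Inr i)))\<^sup>2) < Re (qf y y)"
    unfolding Y(3) sum_distrib_left
    by (rule sum_strict_mono_ex1)
      (use fin i0 in \<open>auto simp: J_def intro!: mult_right_mono bexI[of _ i0] mult_strict_right_mono\<close>)
  also have "\<dots> \<le> Re (qf z z)" by (rule le)
  also have "\<dots> \<le> x * (\<Sum>i\<in>I. (cmod (c (Inl i)))\<^sup>2)"
    unfolding Z(3) sum_distrib_left by (rule sum_mono) (auto simp: I_def intro!: mult_right_mono)
  finally show False using same by simp
qed

text \<open>The counting comparison turned into eigenvalues: the index shift \<open>dA + j\<close>
  is the number of dimensions lost.\<close>

lemma eigv_le:
  assumes A: "selfadjoint A vA" "dA = (if ip vA vA = 0 then 0 else 1)"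
    and B: "selfadjoint B vB" "dB = (if ip vB vB = 0 then 0 else 1)"
    and n: "n' < N - dB" "n + dA + j \<le> n'" and j: "j \<le> 1"
    and linA: "\<And>I c (Y :: nat \<Rightarrow> nat \<Rightarrow> complex). \<phi>A (\<lambda>n. \<Sum>i\<in>I. c i * Y i n) = (\<Sum>i\<in>I. c i * \<phi>A (Y i))"
    and linB: "\<And>I c (Y :: nat \<Rightarrow> nat \<Rightarrow> complex). \<phi>B (\<lambda>n. \<Sum>i\<in>I. c i * Y i n) = (\<Sum>i\<in>I. c i * \<phi>B (Y i))"
    and cmp: "\<And>y z. adm A y \<Longrightarrow> adm B z \<Longrightarrow> (\<forall>n\<in>{1..N}. y n = z n) \<Longrightarrow> (j = 1 \<Longrightarrow> \<phi>A y + \<phi>B z = 0)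
        \<Longrightarrow> Re (qf y y) \<le> Re (qf z z)"
  shows "eigv f q w N A n \<le> eigv f q w N B n'"
proof -
  obtain lA YA where a: "eigenfamily A (N - dA) lA YA"
    "eigv f q w N A n = (LEAST x. n < card {i. i < N - dA \<and> lA i \<le> x})"
    using spectral_data[OF A] by blast
  obtain lB YB where b: "eigenfamily B (N - dB) lB YB"
    "eigv f q w N B n' = (LEAST x. n' < card {i. i < N - dB \<and> lB i \<le> x})"
    using spectral_data[OF B] by blast
  let ?A = "\<lambda>x. card {i. i < N - dA \<and> lA i \<le> x}" and ?B = "\<lambda>x. card {i. i < N - dB \<and> lB i \<le> x}"
  have count: "?B x + (N - dA) \<le> ?A x + N + j" for x
    by (rule eigenvalue_count_comparison[OF a(1) b(1) j linA linB cmp])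
  have bnd: "?A x \<le> N - dA" for x
    using card_mono[of "{..<N - dA}" "{i. i < N - dA \<and> lA i \<le> x}"] by auto
  have "dA \<le> N" using A(2) N2 by auto
  then have step: "n < ?A x" if "n' < ?B x" for x
    using count[of x] that n by linarith
  obtain xB where xB: "n' < ?B xB" "\<And>y. n' < ?B y \<Longrightarrow> xB \<le> y"
    using finite_family_least_exceeding[OF n(1), of lB] by blast
  \<comment> \<open>This ensures that problem \<open>A\<close> has an eigenvalue of index
    \<open>n\<close>.\<close>
  have "n < N - dA" using step[OF xB(1)] bnd[of xB] by linarith
  then obtain xA where xA: "n < ?A xA" "\<And>y. n < ?A y \<Longrightarrow> xA \<le> y"
    using finite_family_least_exceeding[of n "N - dA" lA] by blast
  have "(LEAST x. n < ?A x) = xA" "(LEAST x. n' < ?B x) = xB"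
    using xA xB by (auto intro!: Least_equality)
  then show ?thesis using a(2) b(2) xA(2)[OF step[OF xB(1)]] by simp
qed

text \<open>A sign of \<open>r\<close> orders the forms everywhere (\<open>j = 0\<close>). On the
  kernel of \<open>\<phi>\<close> they coincide, so both orders are available for one extra index
  (\<open>j = 1\<close>).\<close>

lemma interlacing_if_forms_differ_by_square:
  assumes M: "selfadjoint M v" "dM = (if ip v v = 0 then 0 else 1)"
    and K: "selfadjoint K v'" "dK = (if ip v' v' = 0 then 0 else 1)"
    and lin: "\<And>I c (Y :: nat \<Rightarrow> nat \<Rightarrow> complex). \<phi> (\<lambda>n. \<Sum>i\<in>I. c i * Y i n) = (\<Sum>i\<in>I. c i * \<phi> (Y i))"
    and diff: "\<And>y z. adm K y \<Longrightarrow> adm M z \<Longrightarrow> \<forall>n\<in>{1..N}. y n = z n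
      \<Longrightarrow> Re (qf y y) - Re (qf z z) = r * (cmod (\<phi> y))\<^sup>2"
  shows "0 \<le> r \<Longrightarrow> n' < N - dK \<Longrightarrow> n + dM \<le> n' \<Longrightarrow> eigv f q w N M n \<le> eigv f q w N K n'"
    and "r \<le> 0 \<Longrightarrow> n' < N - dM \<Longrightarrow> n + dK \<le> n' \<Longrightarrow> eigv f q w N K n \<le> eigv f q w N M n'"
    and "n' < N - dK \<Longrightarrow> n + dM + 1 \<le> n' \<Longrightarrow> eigv f q w N M n \<le> eigv f q w N K n'"
    and "n' < N - dM \<Longrightarrow> n + dK + 1 \<le> n' \<Longrightarrow> eigv f q w N K n \<le> eigv f q w N M n'"
proof -
  have ge: "Re (qf z z) \<le> Re (qf y y)"
    if "adm K y" "adm M z" "\<forall>n\<in>{1..N}. z n = y n" "0 \<le> r \<or> \<phi> y = 0" for y z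
    using diff[of y z] that mult_nonneg_nonneg[of r "(cmod (\<phi> y))\<^sup>2"] by (auto simp del: mult_nonneg_nonneg)
  have le: "Re (qf y y) \<le> Re (qf z z)"
    if "adm K y" "adm M z" "\<forall>n\<in>{1..N}. y n = z n" "r \<le> 0 \<or> \<phi> y = 0" for y z
    using diff[of y z] that mult_nonpos_nonneg[of r "(cmod (\<phi> y))\<^sup>2"] by auto
  show "eigv f q w N M n \<le> eigv f q w N K n'" if "0 \<le> r" "n' < N - dK" "n + dM \<le> n'"
    by (rule eigv_le[OF M K, where j = 0 and \<phi>A = "\<lambda>_. 0" and \<phi>B = "\<lambda>_. 0"])
      (use that ge in auto)
  show "eigv f q w N K n \<le> eigv f q w N M n'" if "r \<le> 0" "n' < N - dM" "n + dK \<le> n'"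
    by (rule eigv_le[OF K M, where j = 0 and \<phi>A = "\<lambda>_. 0" and \<phi>B = "\<lambda>_. 0"])
      (use that le in auto)
  show "eigv f q w N M n \<le> eigv f q w N K n'" if "n' < N - dK" "n + dM + 1 \<le> n'"
    by (rule eigv_le[OF M K, where j = 1 and \<phi>A = "\<lambda>_. 0" and \<phi>B = \<phi>])
      (use that ge lin in auto)
  show "eigv f q w N K n \<le> eigv f q w N M n'" if "n' < N - dM" "n + dK + 1 \<le> n'"
    by (rule eigv_le[OF K M, where j = 1 and \<phi>A = \<phi> and \<phi>B = "\<lambda>_. 0"])
      (use that le lin in auto)
qed

text \<open>Here \<open>M\<close> is the separated and \<open>K\<close> the coupled condition;
  \<open>s = 0\<close> and \<open>d = 0\<close> mark the respective loss of an eigenvalue. In both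
  cases \<open>d / s = 0\<close>, by division by zero in the former, so each sign hypothesis on
  \<open>r\<close> is met.\<close>

lemma interlacing_cases:
  assumes M: "selfadjoint M v" "ip v v = 0 \<longleftrightarrow> s \<noteq> 0"
    and K: "selfadjoint K v'" "ip v' v' = 0 \<longleftrightarrow> d \<noteq> 0"
    and sd: "s = 0 \<Longrightarrow> d \<noteq> 0"
    and lin: "\<And>I c (Y :: nat \<Rightarrow> nat \<Rightarrow> complex). \<phi> (\<lambda>n. \<Sum>i\<in>I. c i * Y i n) = (\<Sum>i\<in>I. c i * \<phi> (Y i))"
    and diff: "\<And>y z. adm K y \<Longrightarrow> adm M z \<Longrightarrow> \<forall>n\<in>{1..N}. y n = z n
      \<Longrightarrow> Re (qf y y) - Re (qf z z) = d / s * (cmod (\<phi> y))\<^sup>2"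
  shows "s = 0 \<Longrightarrow> n \<le> N - 2 \<Longrightarrow> eigv f q w N K n \<le> eigv f q w N M n"
    "s = 0 \<Longrightarrow> n \<le> N - 2 \<Longrightarrow> eigv f q w N M n \<le> eigv f q w N K (n + 1)"
    "d * s > 0 \<Longrightarrow> n \<le> N - 1 \<Longrightarrow> eigv f q w N M n \<le> eigv f q w N K n"
    "d * s > 0 \<Longrightarrow> n \<le> N - 2 \<Longrightarrow> eigv f q w N K n \<le> eigv f q w N M (n + 1)"
    "d * s < 0 \<Longrightarrow> n \<le> N - 1 \<Longrightarrow> eigv f q w N K n \<le> eigv f q w N M n"
    "d * s < 0 \<Longrightarrow> n \<le> N - 2 \<Longrightarrow> eigv f q w N M n \<le> eigv f q w N K (n + 1)"
    "d = 0 \<Longrightarrow> n \<le> N - 2 \<Longrightarrow> eigv f q w N M n \<le> eigv f q w N K n"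
    "d = 0 \<Longrightarrow> n \<le> N - 2 \<Longrightarrow> eigv f q w N K n \<le> eigv f q w N M (n + 1)"
proof -
  note * = interlacing_if_forms_differ_by_square[OF M(1) refl K(1) refl, of \<phi> "d / s", OF lin diff,
    unfolded M(2) K(2)]
  have pos: "0 \<le> d / s" "s \<noteq> 0" "d \<noteq> 0" if "d * s > 0"
    using that by (auto simp: zero_less_mult_iff zero_le_divide_iff)
  have neg: "d / s \<le> 0" "s \<noteq> 0" "d \<noteq> 0" if "d * s < 0"
    using that by (auto simp: mult_less_0_iff divide_le_0_iff)
  show "eigv f q w N K n \<le> eigv f q w N M n" if "s = 0" "n \<le> N - 2"
    by (rule *(2)) (use that sd N2 in auto)
  show "eigv f q w N M n \<le> eigv f q w N K (n + 1)" if "s = 0" "n \<le> N - 2"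
    by (rule *(1)) (use that sd N2 in auto)
  show "eigv f q w N M n \<le> eigv f q w N K n" if "d * s > 0" "n \<le> N - 1"
    by (rule *(1)) (use that(2) pos[OF that(1)] N2 in auto)
  show "eigv f q w N K n \<le> eigv f q w N M (n + 1)" if "d * s > 0" "n \<le> N - 2"
    by (rule *(4)) (use that(2) pos[OF that(1)] N2 in auto)
  show "eigv f q w N K n \<le> eigv f q w N M n" if "d * s < 0" "n \<le> N - 1"
    by (rule *(2)) (use that(2) neg[OF that(1)] N2 in auto)
  show "eigv f q w N M n \<le> eigv f q w N K (n + 1)" if "d * s < 0" "n \<le> N - 2"
    by (rule *(3)) (use that(2) neg[OF that(1)] N2 in auto)
  show "eigv f q w N M n \<le> eigv f q w N K n" if "d = 0" "n \<le> N - 2"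
    by (rule *(1)) (use that sd N2 in auto)
  show "eigv f q w N K n \<le> eigv f q w N M (n + 1)" if "d = 0" "n \<le> N - 2"
    by (rule *(2)) (use that sd N2 in auto)
qed

subsection \<open>Coupled and separated boundary conditions\<close>

lemma sum_ends:
  assumes "\<And>n. 1 < n \<Longrightarrow> n < N \<Longrightarrow> g n = (0::complex)"
  shows "(\<Sum>n=1..N. g n) = g 1 + g N"
proof -
  have "(\<Sum>n=1..N. g n) = (\<Sum>n\<in>{1,N}. g n)"
  proof (rule sum.mono_neutral_right)
    show "\<forall>n\<in>{1..N} - {1, N}. g n = 0" by (auto intro!: assms)
  qed (use N2 in auto)
  then show ?thesis using N2 by simp
qed

text \<open>Green's formula. Proved for every upper limit \<open>m\<close>, it telescopes.\<close>

lemma lagrange_identity: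
  "qf y z - cnj (qf z y) = of_real (f 0) * (y 1 * cnj (z 0) - y 0 * cnj (z 1))
     - of_real (f N) * (y (Suc N) * cnj (z N) - y N * cnj (z (Suc N)))"
proof -
  have "(\<Sum>n=1..m. L y n * cnj (z n)) - cnj (\<Sum>n=1..m. L z n * cnj (y n))
    = of_real (f 0) * (y 1 * cnj (z 0) - y 0 * cnj (z 1))
     - of_real (f m) * (y (Suc m) * cnj (z m) - y m * cnj (z (Suc m)))" for m
    by (induction m) (auto simp: L_def algebra_simps)
  then show ?thesis by (simp add: qf_def)
qed

lemma qf_symmetric_if_wronskians_agree:
  assumes "of_real (f 0) * (y 1 - y 0) * cnj (z 0) - y 0 * cnj (of_real (f 0) * (z 1 - z 0))
      = of_real (f N) * (y (Suc N) - y N) * cnj (z N) - y N * cnj (of_real (f N) * (z (Suc N) - z N))"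
  shows "qf y z = cnj (qf z y)"
  using lagrange_identity[of y z] assms by (simp add: algebra_simps)

text \<open>The end values enter \<open>L\<close> only at 1 and \<open>N\<close>, so all other terms
  cancel.\<close>

lemma qf_diff_same_interior:
  assumes eq: "\<forall>n\<in>{1..N}. y n = z n"
  shows "qf y y - qf z z = - of_real (f 0) * (y 0 - z 0) * cnj (y 1)
     - of_real (f N) * (y (Suc N) - z (Suc N)) * cnj (y N)"
proof -
  have e: "y n = z n" if "1 \<le> n" "n \<le> N" for n using eq that by auto
  have "qf y y - qf z z = (\<Sum>n=1..N. (L y n - L z n) * cnj (y n))"
    using eq by (simp add: qf_def sum_subtractf algebra_simps)
  also have "\<dots> = (L y 1 - L z 1) * cnj (y 1) + (L y N - L z N) * cnj (y N)"
    by (rule sum_ends) (auto simp: L_def e)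
  also have "L y 1 - L z 1 = - of_real (f 0) * (y 0 - z 0)"
    using N2 e[of 1] e[of 2] by (simp add: L_def numeral_2_eq_2 algebra_simps)
  also have "L y N - L z N = - of_real (f N) * (y (Suc N) - z (Suc N))"
    using N2 e[of N] e[of "N - 1"] by (simp add: L_def algebra_simps)
  finally show ?thesis by simp
qed

definition extend :: "complex \<Rightarrow> (nat \<Rightarrow> complex) \<Rightarrow> complex \<Rightarrow> nat \<Rightarrow> complex" where
  "extend a u b n = (if n = 0 then a else if n \<le> N then u n else if n = Suc N then b else 0)"

lemma extend_simps [simp]:
  "extend a u b 0 = a" "extend a u b (Suc N) = b" "extend a u b 1 = u 1" "extend a u b (Suc 0) = u 1"
  "extend a u b N = u N" "n \<in> {1..N} \<Longrightarrow> extend a u b n = u n" "n > Suc N \<Longrightarrow> extend a u b n = 0"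
  using N2 by (auto simp: extend_def)

lemma L_extend:
  "L (extend a u b) 1 = - (of_real (f 1) * (u 2 - u 1) - of_real (f 0) * (u 1 - a)) + of_real (q 1) * u 1"
  "L (extend a u b) N = - (of_real (f N) * (b - u N) - of_real (f (N - 1)) * (u N - u (N - 1))) + of_real (q N) * u N"
  using N2 by (auto simp: L_def extend_def numeral_2_eq_2)

lemma less_2_all: "(\<forall>i<2. P i) \<longleftrightarrow> P 0 \<and> P (1::nat)"
  by (auto simp: less_Suc_eq numeral_2_eq_2)

section \<open>Boundary conditions in terms of end values\<close>

lemma adm_coupled_iff:
  "adm (coupled_bc \<gamma> k11 k12 k21 k22) y \<longleftrightarrow> (\<forall>n>Suc N. y n = 0)
   \<and> y N = cis \<gamma> * (of_real k11 * y 0 + of_real k12 * (of_real (f 0) * (y 1 - y 0)))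
   \<and> of_real (f N) * (y (Suc N) - y N) = cis \<gamma> * (of_real k21 * y 0 + of_real k22 * (of_real (f 0) * (y 1 - y 0)))"
  by (auto simp: adm_def bc_holds_def less_2_all coupled_bc_def mat24_def algebra_simps)

lemma adm_S_iff:
  "adm (S_bc k11 k12 k21 k22) y \<longleftrightarrow> (\<forall>n>Suc N. y n = 0)
   \<and> y 0 = 0 \<and> of_real k12 * (of_real (f N) * (y (Suc N) - y N)) = of_real k22 * y N"
  by (auto simp: adm_def bc_holds_def less_2_all S_bc_def mat24_def algebra_simps)

lemma adm_V_iff:
  "adm (V_bc k11 k12 k21 k22) y \<longleftrightarrow> (\<forall>n>Suc N. y n = 0)
   \<and> of_real k21 * y 0 + of_real k22 * (of_real (f 0) * (y 1 - y 0)) = 0 \<and> y (Suc N) = y N"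
  using f_nz[of N] by (auto simp: adm_def bc_holds_def less_2_all V_bc_def mat24_def algebra_simps)

text \<open>Symmetry reduces to equal Wronskians at both ends, and lifting an interior vector to
  choosing its two end values.\<close>

lemma selfadjointI:
  assumes "\<And>y z. adm M y \<Longrightarrow> adm M z \<Longrightarrow>
      of_real (f 0) * (y 1 - y 0) * cnj (z 0) - y 0 * cnj (of_real (f 0) * (z 1 - z 0))
      = of_real (f N) * (y (Suc N) - y N) * cnj (z N) - y N * cnj (of_real (f N) * (z (Suc N) - z N))"
    and "\<And>y. adm M y \<Longrightarrow> ip y v = 0"
    and "\<And>u. ip u v = 0 \<Longrightarrow> \<exists>a b. adm M (extend a u b) \<and> qf (extend a u b) v = 0"
  shows "selfadjoint M v"
  unfolding selfadjoint_def
proof (intro conjI allI impI)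
  show "\<exists>y. adm M y \<and> (\<forall>n\<in>{1..N}. y n = u n) \<and> qf y v = 0" if "ip u v = 0" for u
    using assms(3)[OF that] by (metis extend_simps(6))
qed (use assms qf_symmetric_if_wronskians_agree in blast)+

lemma ip_zero: "ip y (\<lambda>_. 0) = 0" "qf y (\<lambda>_. 0) = 0"
  by (auto simp: ip_def qf_def)

text \<open>Both pairs lie on the same line with real coefficients. Multiplying by \<open>a\<close>
  and by \<open>b\<close> avoids dividing by a coefficient that may be zero.\<close>

lemma separated_wronskian_0:
  fixes a b :: real and y p z r :: complex
  assumes "of_real a * p = of_real b * y" "of_real a * r = of_real b * z" "a \<noteq> 0 \<or> b \<noteq> 0"
  shows "p * cnj z - y * cnj r = 0"
proof -
  have c: "of_real a * cnj r = of_real b * cnj z" using arg_cong[OF assms(2), of cnj] by simp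
  have "of_real a * (p * cnj z - y * cnj r) = (of_real a * p) * cnj z - y * (of_real a * cnj r)"
    by (simp add: algebra_simps)
  also have "\<dots> = 0" unfolding assms(1) c by simp
  finally have A: "of_real a * (p * cnj z - y * cnj r) = 0" .
  have "of_real b * (p * cnj z - y * cnj r) = p * (of_real b * cnj z) - (of_real b * y) * cnj r"
    by (simp add: algebra_simps)
  also have "\<dots> = 0" unfolding assms(1)[symmetric] c[symmetric] by simp
  finally show ?thesis using A assms(3) by auto
qed

text \<open>In the degenerate cases the normal vector is, up to a scalar, \<open>1/w\<close> times \<open>L\<close> applied to the
  admissible sequence vanishing on \<open>{1..N}\<close>.\<close>

definition normal_S :: "real \<Rightarrow> nat \<Rightarrow> complex" where
  "normal_S k12 = (\<lambda>n. if k12 = 0 \<and> n = N then 1 else 0)"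

definition normal_V :: "real \<Rightarrow> real \<Rightarrow> nat \<Rightarrow> complex" where
  "normal_V k21 k22 = (\<lambda>n. if f 0 * k22 - k21 = 0 \<and> n = 1 then 1 else 0)"

definition normal_coupled :: "real \<Rightarrow> real \<Rightarrow> real \<Rightarrow> nat \<Rightarrow> complex" where
  "normal_coupled \<gamma> k11 k12 = (\<lambda>n. if k11 - f 0 * k12 \<noteq> 0 then 0
     else if n = 1 then - of_real (f 0 * k12 / w 1) else if n = N then cis \<gamma> / of_real (w N) else 0)"

lemma w_ends: "w 1 > 0" "w (Suc 0) > 0" "w N > 0" using w_pos[of 1] w_pos[of N] N2 by auto

lemma ip_normal_S_self: "ip (normal_S k12) (normal_S k12) = 0 \<longleftrightarrow> k12 \<noteq> 0"
  unfolding ip_self_eq_0_iff normal_S_def using N2 by force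

lemma ip_normal_V_self: "ip (normal_V k21 k22) (normal_V k21 k22) = 0 \<longleftrightarrow> f 0 * k22 - k21 \<noteq> 0"
  unfolding ip_self_eq_0_iff normal_V_def using N2 by force

lemma ip_normal_coupled_self: "ip (normal_coupled \<gamma> k11 k12) (normal_coupled \<gamma> k11 k12) = 0 \<longleftrightarrow> k11 - f 0 * k12 \<noteq> 0"
proof -
  have "\<exists>n\<in>{1..N}. normal_coupled \<gamma> k11 k12 n \<noteq> 0" if "k11 - f 0 * k12 = 0"
    using N2 that w_ends by (intro bexI[of _ N]) (auto simp: normal_coupled_def)
  moreover have "normal_coupled \<gamma> k11 k12 n = 0" if "k11 - f 0 * k12 \<noteq> 0" for n
    using that by (simp add: normal_coupled_def)
  ultimately show ?thesis unfolding ip_self_eq_0_iff by blast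
qed

lemma cis_cnj_mult: "cis \<gamma> * x * (cnj (cis \<gamma>) * y) = x * y"
proof -
  have "cis \<gamma> * cnj (cis \<gamma>) = 1" by (simp add: cis_cnj cis_mult)
  then show ?thesis by (metis (no_types, opaque_lifting) mult.assoc mult.commute mult_1)
qed

text \<open>Sorted by \<open>y 0\<close> and \<open>y 1\<close>, the first equation shows that
  \<open>y 0\<close> is determined by the interior unless \<open>k11 - f 0 * k12 = 0\<close>, when
  it constrains the interior.\<close>

lemma adm_coupled_iff_grouped:
  "adm (coupled_bc \<gamma> k11 k12 k21 k22) y \<longleftrightarrow> (\<forall>n>Suc N. y n = 0)
   \<and> y N = cis \<gamma> * (of_real (k11 - f 0 * k12) * y 0 + of_real k12 * of_real (f 0) * y 1)
   \<and> of_real (f N) * (y (Suc N) - y N)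
     = cis \<gamma> * (of_real k22 * of_real (f 0) * y 1 - of_real (f 0 * k22 - k21) * y 0)"
  unfolding adm_coupled_iff by (simp add: algebra_simps)

section \<open>Self-adjointness of the three boundary conditions\<close>

context
  fixes k11 k12 k21 k22 :: real
  assumes SL2: "k11 * k22 - k12 * k21 = 1"
begin

lemma S_wronskian:
  assumes "adm (S_bc k11 k12 k21 k22) y" "adm (S_bc k11 k12 k21 k22) z"
  shows "of_real (f 0) * (y 1 - y 0) * cnj (z 0) - y 0 * cnj (of_real (f 0) * (z 1 - z 0))
      = of_real (f N) * (y (Suc N) - y N) * cnj (z N) - y N * cnj (of_real (f N) * (z (Suc N) - z N))"
proof -
  have "of_real (f N) * (y (Suc N) - y N) * cnj (z N) - y N * cnj (of_real (f N) * (z (Suc N) - z N)) = 0"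
    by (rule separated_wronskian_0[of k12 _ k22]) (use assms SL2 in \<open>auto simp: adm_S_iff\<close>)
  then show ?thesis using assms by (simp add: adm_S_iff)
qed

lemma V_wronskian:
  assumes "adm (V_bc k11 k12 k21 k22) y" "adm (V_bc k11 k12 k21 k22) z"
  shows "of_real (f 0) * (y 1 - y 0) * cnj (z 0) - y 0 * cnj (of_real (f 0) * (z 1 - z 0))
      = of_real (f N) * (y (Suc N) - y N) * cnj (z N) - y N * cnj (of_real (f N) * (z (Suc N) - z N))"
proof -
  have "of_real (f 0) * (y 1 - y 0) * cnj (z 0) - y 0 * cnj (of_real (f 0) * (z 1 - z 0)) = 0"
    by (rule separated_wronskian_0[of k22 _ "- k21"])
      (use assms SL2 in \<open>auto simp: adm_V_iff add_eq_0_iff\<close>)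
  then show ?thesis using assms by (simp add: adm_V_iff)
qed

lemma SL2_complex: "complex_of_real k11 * of_real k22 = 1 + of_real k12 * of_real k21"
proof -
  have "k11 * k22 = 1 + k12 * k21" using SL2 by simp
  from arg_cong[OF this, of complex_of_real] show ?thesis by simp
qed

text \<open>A real matrix of determinant 1 preserves the Wronskian, and the phase cancels against
  its conjugate.\<close>

lemma coupled_wronskian:
  assumes "adm (coupled_bc \<gamma> k11 k12 k21 k22) y" "adm (coupled_bc \<gamma> k11 k12 k21 k22) z"
  shows "of_real (f 0) * (y 1 - y 0) * cnj (z 0) - y 0 * cnj (of_real (f 0) * (z 1 - z 0))
      = of_real (f N) * (y (Suc N) - y N) * cnj (z N) - y N * cnj (of_real (f N) * (z (Suc N) - z N))"
proof -
  define p where "p = of_real (f 0) * (y 1 - y 0)"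
  define r where "r = of_real (f 0) * (z 1 - z 0)"
  have y: "y N = cis \<gamma> * (of_real k11 * y 0 + of_real k12 * p)"
    "of_real (f N) * (y (Suc N) - y N) = cis \<gamma> * (of_real k21 * y 0 + of_real k22 * p)"
    and z: "z N = cis \<gamma> * (of_real k11 * z 0 + of_real k12 * r)"
    "of_real (f N) * (z (Suc N) - z N) = cis \<gamma> * (of_real k21 * z 0 + of_real k22 * r)"
    using assms by (auto simp: adm_coupled_iff p_def r_def)
  have "of_real (f N) * (y (Suc N) - y N) * cnj (z N) - y N * cnj (of_real (f N) * (z (Suc N) - z N))
    = (of_real k21 * y 0 + of_real k22 * p) * (of_real k11 * cnj (z 0) + of_real k12 * cnj r)
    - (of_real k11 * y 0 + of_real k12 * p) * (of_real k21 * cnj (z 0) + of_real k22 * cnj r)"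
    unfolding y(2) z(2) unfolding y(1) z(1) complex_cnj_mult cis_cnj_mult by simp
  also have "\<dots> = (of_real k11 * of_real k22 - of_real k12 * of_real k21) * (p * cnj (z 0) - y 0 * cnj r)"
    by (simp add: algebra_simps)
  also have "\<dots> = p * cnj (z 0) - y 0 * cnj r" by (simp add: SL2_complex)
  finally show ?thesis by (simp add: p_def r_def)
qed

lemma selfadjoint_S: "selfadjoint (S_bc k11 k12 k21 k22) (normal_S k12)"
proof (cases "k12 = 0")
  case True
  then have k22: "k22 \<noteq> 0" using SL2 by auto
  have ipv: "ip u (normal_S k12) = of_real (w N) * u N" for u
    unfolding ip_def by (subst sum_ends) (use True N2 in \<open>auto simp: normal_S_def\<close>)
  have qfv: "qf y (normal_S k12) = L y N" for y
    unfolding qf_def by (subst sum_ends) (use True N2 in \<open>auto simp: normal_S_def\<close>)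
  show ?thesis
  proof (rule selfadjointI[OF S_wronskian])
    show "ip y (normal_S k12) = 0" if "adm (S_bc k11 k12 k21 k22) y" for y
      unfolding ipv using that True k22 by (simp add: adm_S_iff)
    fix u assume "ip u (normal_S k12) = 0"
    then have u: "u N = 0" using w_ends by (simp add: ipv)
    \<comment> \<open>The condition leaves \<open>y (Suc N)\<close> free; this value makes
      \<open>L\<close> vanish at \<open>N\<close>.\<close>
    define b where "b = (of_real (f (N - 1)) * (u N - u (N - 1)) + of_real (q N) * u N) / of_real (f N)"
    have "qf (extend 0 u b) (normal_S k12) = 0"
      unfolding qfv L_extend(2) using u f_nz[of N] by (simp add: b_def)
    then show "\<exists>a b. adm (S_bc k11 k12 k21 k22) (extend a u b) \<and> qf (extend a u b) (normal_S k12) = 0"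
      using True u by - (rule exI[of _ 0], rule exI[of _ b], simp add: adm_S_iff)
  qed
next
  case False
  then have v: "(normal_S k12) = (\<lambda>_. 0)" by (simp add: normal_S_def)
  show ?thesis
  proof (rule selfadjointI[OF S_wronskian])
    fix u :: "nat \<Rightarrow> complex"
    show "\<exists>a b. adm (S_bc k11 k12 k21 k22) (extend a u b) \<and> qf (extend a u b) (normal_S k12) = 0"
      using False f_nz[of N]
      by - (rule exI[of _ 0], rule exI[of _ "u N + of_real k22 * u N / (of_real k12 * of_real (f N))"], simp add: v ip_zero adm_S_iff)
  qed (auto simp: v ip_zero)
qed

lemma selfadjoint_V: "selfadjoint (V_bc k11 k12 k21 k22) (normal_V k21 k22)"
proof (cases "f 0 * k22 - k21 = 0")
  case True
  then have k21: "k21 = f 0 * k22" by simp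
  then have k22: "k22 \<noteq> 0" using SL2 by auto
  have ipv: "ip u (normal_V k21 k22) = of_real (w 1) * u 1" for u
    unfolding ip_def by (subst sum_ends) (use True N2 in \<open>auto simp: normal_V_def\<close>)
  have qfv: "qf y (normal_V k21 k22) = L y 1" for y
    unfolding qf_def by (subst sum_ends) (use True N2 in \<open>auto simp: normal_V_def\<close>)
  have bc: "of_real k21 * y + of_real k22 * (of_real (f 0) * (z - y)) = 0 \<longleftrightarrow> z = 0" for y z :: complex
    using k22 f_nz[of 0] by (simp add: k21 algebra_simps)
  show ?thesis
  proof (rule selfadjointI[OF V_wronskian])
    show "ip y (normal_V k21 k22) = 0" if "adm (V_bc k11 k12 k21 k22) y" for y
      using that by (simp add: ipv adm_V_iff bc)
    fix u assume "ip u (normal_V k21 k22) = 0"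
    then have u: "u 1 = 0" using w_ends by (simp add: ipv)
    \<comment> \<open>The condition leaves \<open>y 0\<close> free; this value makes
      \<open>L\<close> vanish at 1.\<close>
    define a where "a = - (of_real (f 1) * u 2 / of_real (f 0))"
    have adm: "adm (V_bc k11 k12 k21 k22) (extend a u (u N))"
      unfolding adm_V_iff extend_simps bc using u by simp
    have "qf (extend a u (u N)) (normal_V k21 k22) = 0"
      unfolding qfv L_extend(1) using u f_nz[of 0] by (simp add: a_def)
    then show "\<exists>a b. adm (V_bc k11 k12 k21 k22) (extend a u b) \<and> qf (extend a u b) (normal_V k21 k22) = 0"
      using adm by blast
  qed
next
  case False
  then have v: "(normal_V k21 k22) = (\<lambda>_. 0)" by (simp add: normal_V_def)
  show ?thesis
  proof (rule selfadjointI[OF V_wronskian])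
    fix u :: "nat \<Rightarrow> complex"
    define g where "g = of_real (f 0) * of_real k22 - complex_of_real k21"
    have g: "g \<noteq> 0" using False by (metis g_def of_real_diff of_real_eq_0_iff of_real_mult)
    define a where "a = of_real k22 * of_real (f 0) * u 1 / g"
    have "of_real k21 * a + of_real k22 * (of_real (f 0) * (u 1 - a)) = of_real k22 * of_real (f 0) * u 1 - g * a"
      by (simp add: g_def algebra_simps)
    also have "\<dots> = 0" using g by (simp add: a_def)
    finally show "\<exists>a b. adm (V_bc k11 k12 k21 k22) (extend a u b) \<and> qf (extend a u b) (normal_V k21 k22) = 0"
      by - (rule exI[of _ a], rule exI[of _ "u N"], simp add: v ip_zero adm_V_iff)
  qed (auto simp: v ip_zero)
qed

lemma selfadjoint_coupled: "selfadjoint (coupled_bc \<gamma> k11 k12 k21 k22) (normal_coupled \<gamma> k11 k12)"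
proof (cases "k11 - f 0 * k12 = 0")
  case True
  define g where "g = f 0 * k22 - k21"
  have "k12 * g = 1" using True SL2 by (simp add: g_def algebra_simps)
  then have k12: "k12 \<noteq> 0" by auto
  then have g: "g = 1 / k12" using \<open>k12 * g = 1\<close> by (simp add: field_simps)
  have ipv: "ip u (normal_coupled \<gamma> k11 k12) = cnj (cis \<gamma>) * u N - of_real (f 0 * k12) * u 1" for u
    unfolding ip_def by (subst sum_ends) (use True N2 w_ends in \<open>auto simp: normal_coupled_def\<close>)
  have ipv0: "ip u (normal_coupled \<gamma> k11 k12) = 0 \<longleftrightarrow> u N = cis \<gamma> * (of_real k12 * of_real (f 0) * u 1)" for u
  proof -
    have "cis \<gamma> * ip u (normal_coupled \<gamma> k11 k12) = u N - cis \<gamma> * (of_real k12 * of_real (f 0) * u 1)"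
      using cis_cnj_mult[of \<gamma> 1 "u N"] unfolding ipv by (simp add: algebra_simps)
    then show ?thesis using cis_neq_zero[of \<gamma>] by (metis eq_iff_diff_eq_0 mult_eq_0_iff)
  qed
  have qfv: "qf y (normal_coupled \<gamma> k11 k12) = cnj (cis \<gamma>) * L y N / of_real (w N) - of_real (f 0 * k12 / w 1) * L y 1" for y
    unfolding qf_def by (subst sum_ends) (use True N2 w_ends in \<open>auto simp: normal_coupled_def mult_ac\<close>)
  show ?thesis
  proof (rule selfadjointI[OF coupled_wronskian])
    show "ip y (normal_coupled \<gamma> k11 k12) = 0" if "adm (coupled_bc \<gamma> k11 k12 k21 k22) y" for y
      using that True unfolding ipv0 adm_coupled_iff_grouped by simp
    fix u assume "ip u (normal_coupled \<gamma> k11 k12) = 0"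
    then have u: "u N = cis \<gamma> * (of_real k12 * of_real (f 0) * u 1)" by (simp only: ipv0)
    define p where "p a = cis \<gamma> * (of_real k22 * of_real (f 0) * u 1 - of_real g * a)" for a
    \<comment> \<open>The admissible lifts of \<open>u\<close> form a family with free left end
      value \<open>a\<close>; the pairing with the normal vector is affine in
      \<open>a\<close>.\<close>
    define y where "y a = extend a u (u N + p a / of_real (f N))" for a
    have adm: "adm (coupled_bc \<gamma> k11 k12 k21 k22) (y a)" for a
      unfolding adm_coupled_iff_grouped using True u f_nz[of N] by (simp add: y_def p_def g_def)
    define s where "s = g / w N + f 0 * k12 * f 0 / w 1"
    have lin: "qf (y a) (normal_coupled \<gamma> k11 k12) = qf (y 0) (normal_coupled \<gamma> k11 k12) + of_real s * a" for a
    proof -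
      have LN: "L (y a) N = L (y 0) N + cis \<gamma> * (of_real g * a)"
        unfolding y_def L_extend using f_nz[of N] by (simp add: p_def field_simps)
      have L1: "L (y a) 1 = L (y 0) 1 - of_real (f 0) * a"
        unfolding y_def L_extend by (simp add: algebra_simps)
      have "qf (y a) (normal_coupled \<gamma> k11 k12) - qf (y 0) (normal_coupled \<gamma> k11 k12)
          = (cis \<gamma> * 1 * (cnj (cis \<gamma>) * (of_real g * a))) / of_real (w N) + of_real (f 0 * k12 / w 1) * of_real (f 0) * a"
        unfolding qfv LN L1 by (simp add: algebra_simps add_divide_distrib diff_divide_distrib)
      also have "\<dots> = of_real s * a"
        unfolding cis_cnj_mult by (simp add: s_def algebra_simps)
      finally show ?thesis by (simp add: algebra_simps)
    qed
    \<comment> \<open>Positivity of \<open>s * k12\<close> makes the slope \<open>s\<close> nonzero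
      whatever the sign of \<open>k12\<close>, so the affine function has a zero.\<close>
    have "s * k12 = 1 / w N + (f 0 * k12)\<^sup>2 / w 1"
      using k12 by (simp add: s_def g power2_eq_square algebra_simps)
    also have "\<dots> > 0" using w_ends by (intro add_pos_nonneg) auto
    finally have "s \<noteq> 0" by auto
    then have "qf (y (- qf (y 0) (normal_coupled \<gamma> k11 k12) / of_real s)) (normal_coupled \<gamma> k11 k12) = 0" by (subst lin) simp
    then show "\<exists>a b. adm (coupled_bc \<gamma> k11 k12 k21 k22) (extend a u b) \<and> qf (extend a u b) (normal_coupled \<gamma> k11 k12) = 0"
      using adm unfolding y_def by blast
  qed
next
  case False
  then have v: "normal_coupled \<gamma> k11 k12 = (\<lambda>_. 0)" by (simp add: normal_coupled_def)
  show ?thesis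
  proof (rule selfadjointI[OF coupled_wronskian])
    fix u :: "nat \<Rightarrow> complex"
    define d where "d = k11 - f 0 * k12"
    have d: "d \<noteq> 0" using False by (simp add: d_def)
    \<comment> \<open>The first coupled equation solved for \<open>y 0\<close>, with
      \<open>cnj (cis \<gamma>)\<close> as the inverse of the phase.\<close>
    define a where "a = (cnj (cis \<gamma>) * u N - of_real k12 * of_real (f 0) * u 1) / of_real d"
    define p where "p = cis \<gamma> * (of_real k22 * of_real (f 0) * u 1 - of_real (f 0 * k22 - k21) * a)"
    have "of_real d * a + of_real k12 * of_real (f 0) * u 1 = cnj (cis \<gamma>) * u N"
      using d by (simp add: a_def)
    then have "u N = cis \<gamma> * (of_real d * a + of_real k12 * of_real (f 0) * u 1)"
      using cis_cnj_mult[of \<gamma> 1 "u N"] by simp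
    then show "\<exists>a b. adm (coupled_bc \<gamma> k11 k12 k21 k22) (extend a u b) \<and> qf (extend a u b) (normal_coupled \<gamma> k11 k12) = 0"
      unfolding adm_coupled_iff_grouped using f_nz[of N]
      by - (rule exI[of _ a], rule exI[of _ "u N + p / of_real (f N)"], simp add: v ip_zero d_def p_def)
  qed (auto simp: v ip_zero)
qed

section \<open>Differences of the quadratic forms\<close>

text \<open>As \<open>z 0 = 0\<close>, the left ends differ by \<open>y 0\<close>; by the
  determinant condition the right ends, scaled by \<open>k12 * f N\<close>, differ by
  \<open>- cis \<gamma> * y 0\<close>. So only a multiple of the squared modulus of
  \<open>y 0\<close> survives.\<close>

lemma qf_coupled_minus_S:
  assumes y: "adm (coupled_bc \<gamma> k11 k12 k21 k22) y" and z: "adm (S_bc k11 k12 k21 k22) z"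
    and eq: "\<forall>n\<in>{1..N}. y n = z n"
  shows "Re (qf y y) - Re (qf z z) = (k11 - f 0 * k12) / k12 * (cmod (y 0))\<^sup>2"
proof -
  define p where "p = of_real (f 0) * (y 1 - y 0)"
  define c where "c = cis \<gamma>"
  have yN: "y N = c * (of_real k11 * y 0 + of_real k12 * p)"
    and pN: "of_real (f N) * (y (Suc N) - y N) = c * (of_real k21 * y 0 + of_real k22 * p)"
    using y by (auto simp: adm_coupled_iff p_def c_def)
  have z0: "z 0 = 0" and zN: "of_real k12 * (of_real (f N) * (z (Suc N) - y N)) = of_real k22 * y N"
    using z eq N2 by (auto simp: adm_S_iff)
  have diff: "qf y y - qf z z = - of_real (f 0) * y 0 * cnj (y 1)
     - of_real (f N) * (y (Suc N) - z (Suc N)) * cnj (y N)"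
    using qf_diff_same_interior[OF eq] z0 by simp
  show ?thesis
  proof (cases "k12 = 0")
    \<comment> \<open>Here \<open>y 0\<close> and \<open>y N\<close> are forced to be 0, so the
      forms agree, as the value 0 of the quotient demands.\<close>
    case True
    then have "k22 \<noteq> 0" "k11 \<noteq> 0" using SL2 by auto
    then have "y N = 0" using zN True by simp
    moreover from this have "y 0 = 0" using yN True \<open>k11 \<noteq> 0\<close> by (simp add: c_def)
    ultimately have "qf y y - qf z z = 0" using diff by simp
    from arg_cong[OF this, of Re] True show ?thesis by simp
  next
    case False
    have "of_real k12 * (of_real (f N) * (y (Suc N) - z (Suc N)))
        = of_real k12 * (of_real (f N) * (y (Suc N) - y N)) - of_real k12 * (of_real (f N) * (z (Suc N) - y N))"
      by (simp add: algebra_simps)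
    also have "\<dots> = c * ((of_real k12 * of_real k21 - of_real k11 * of_real k22) * y 0)"
      unfolding zN pN by (subst yN) (simp add: algebra_simps)
    also have "\<dots> = - c * y 0" by (simp add: SL2_complex)
    finally have e: "of_real k12 * (of_real (f N) * (y (Suc N) - z (Suc N))) = - c * y 0" .
    have cN: "c * y 0 * cnj (y N) = y 0 * (of_real k11 * cnj (y 0) + of_real k12 * cnj p)"
      unfolding yN complex_cnj_mult using cis_cnj_mult[of \<gamma> "y 0"] by (simp add: c_def)
    have "of_real k12 * (qf y y - qf z z) = - of_real k12 * of_real (f 0) * y 0 * cnj (y 1)
       - (of_real k12 * (of_real (f N) * (y (Suc N) - z (Suc N)))) * cnj (y N)"
      unfolding diff by (simp add: algebra_simps)
    also have "\<dots> = of_real (k11 - f 0 * k12) * (y 0 * cnj (y 0))"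
      unfolding e using cN by (simp add: p_def algebra_simps)
    also have "y 0 * cnj (y 0) = of_real ((cmod (y 0))\<^sup>2)" by (simp only: complex_norm_square)
    finally have "of_real k12 * (qf y y - qf z z) = of_real ((k11 - f 0 * k12) * (cmod (y 0))\<^sup>2)" by simp
    from arg_cong[OF this, of Re] have "k12 * (Re (qf y y) - Re (qf z z)) = (k11 - f 0 * k12) * (cmod (y 0))\<^sup>2"
      by (simp only: Re_complex_of_real) simp
    then show ?thesis using False by (simp add: field_simps)
  qed
qed

text \<open>As \<open>z (Suc N) = y N\<close>, the right ends contribute \<open>p\<close>, and the
  left ends, scaled by \<open>g\<close>, differ by \<open>- cnj c * p\<close>; both boundary terms
  thus carry a factor \<open>p\<close>.\<close>

lemma qf_coupled_minus_V:
  assumes y: "adm (coupled_bc \<gamma> k11 k12 k21 k22) y" and z: "adm (V_bc k11 k12 k21 k22) z"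
    and eq: "\<forall>n\<in>{1..N}. y n = z n"
  shows "Re (qf y y) - Re (qf z z)
     = (k11 - f 0 * k12) / (f 0 * k22 - k21) * (cmod (of_real (f N) * (y (Suc N) - y N)))\<^sup>2"
proof -
  define d where "d = k11 - f 0 * k12"
  define g where "g = f 0 * k22 - k21"
  define c where "c = cis \<gamma>"
  define p where "p = of_real (f N) * (y (Suc N) - y N)"
  \<comment> \<open>The determinant condition rewritten in \<open>d\<close> and
    \<open>g\<close>.\<close>
  have dg: "d * k22 + g * k12 = 1" using SL2 by (simp add: d_def g_def algebra_simps)
  have yN: "y N = c * (of_real d * y 0 + of_real k12 * of_real (f 0) * y 1)"
    and pN: "p = c * (of_real k22 * of_real (f 0) * y 1 - of_real g * y 0)"
    using y by (auto simp: adm_coupled_iff_grouped d_def g_def c_def p_def)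
  have zN: "z (Suc N) = y N" using z eq N2 by (auto simp: adm_V_iff)
  have "of_real k21 * z 0 + of_real k22 * (of_real (f 0) * (y 1 - z 0)) = 0"
    using z eq N2 by (simp add: adm_V_iff)
  then have z0: "of_real k22 * of_real (f 0) * y 1 = of_real g * z 0" by (simp add: g_def algebra_simps)
  have diff: "qf y y - qf z z = - of_real (f 0) * (y 0 - z 0) * cnj (y 1) - p * cnj (y N)"
    using qf_diff_same_interior[OF eq] zN by (simp add: p_def)
  show ?thesis
  proof (cases "g = 0")
    \<comment> \<open>Here \<open>y 1\<close> and \<open>p\<close> are forced to be 0, so the forms
      agree.\<close>
    case True
    then have "k22 \<noteq> 0" using dg by auto
    then have "y 1 = 0" using z0 True f_nz[of 0] by simp
    moreover from this have "p = 0" using pN True by simp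
    ultimately have "qf y y - qf z z = 0" using diff by simp
    from arg_cong[OF this, of Re] True show ?thesis by (simp add: g_def)
  next
    case False
    have pz: "p = c * (of_real g * (z 0 - y 0))" unfolding pN z0 by (simp add: algebra_simps)
    have "c * 1 * (cnj c * (of_real g * (z 0 - y 0))) = of_real g * (z 0 - y 0)"
      unfolding c_def cis_cnj_mult by simp
    then have e: "of_real g * (y 0 - z 0) = - cnj c * p" unfolding pz by (simp add: algebra_simps)
    have "of_real g * y N = c * (of_real d * (of_real g * y 0) + of_real (g * k12) * of_real (f 0) * y 1)"
      unfolding yN by (simp add: algebra_simps)
    also have "g * k12 = 1 - d * k22" using dg by simp
    also have "c * (of_real d * (of_real g * y 0) + of_real (1 - d * k22) * of_real (f 0) * y 1)
       = c * of_real (f 0) * y 1 - of_real d * p"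
      unfolding pN by (simp add: algebra_simps)
    finally have "cnj (of_real g * y N) = cnj (c * of_real (f 0) * y 1 - of_real d * p)" by simp
    then have b: "of_real g * cnj (y N) = cnj c * of_real (f 0) * cnj (y 1) - of_real d * cnj p" by simp
    have "of_real g * (qf y y - qf z z) = - of_real (f 0) * (of_real g * (y 0 - z 0)) * cnj (y 1)
       - p * (of_real g * cnj (y N))"
      unfolding diff by (simp add: algebra_simps)
    also have "\<dots> = of_real d * (p * cnj p)"
      unfolding e b by (simp add: algebra_simps)
    also have "p * cnj p = of_real ((cmod p)\<^sup>2)" by (simp only: complex_norm_square)
    finally have "of_real g * (qf y y - qf z z) = of_real (d * (cmod p)\<^sup>2)" by simp
    from arg_cong[OF this, of Re] have "g * (Re (qf y y) - Re (qf z z)) = d * (cmod p)\<^sup>2"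
      by (simp only: Re_complex_of_real) simp
    then show ?thesis using False unfolding p_def[symmetric] d_def[symmetric] g_def[symmetric]
      by (simp add: field_simps)
  qed
qed

lemma has_eigs_S: "has_eigs f q w N (S_bc k11 k12 k21 k22) (N - (if k12 \<noteq> 0 then 0 else 1))"
  using spectral_data[OF selfadjoint_S refl] unfolding ip_normal_S_self by blast

lemma has_eigs_V: "has_eigs f q w N (V_bc k11 k12 k21 k22) (N - (if f 0 * k22 - k21 \<noteq> 0 then 0 else 1))"
  using spectral_data[OF selfadjoint_V refl] unfolding ip_normal_V_self by blast

end

end

theorem theorem3p7:
  fixes f q w :: "nat \<Rightarrow> real" and N :: nat and k11 k12 k21 k22 \<gamma> :: real
  assumes N2: "N \<ge> 2"
    and f_nz: "\<forall>n\<le>N. f n \<noteq> 0"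
    and w_pos: "\<forall>n\<in>{1..N}. w n > 0"
    and SL2: "k11 * k22 - k12 * k21 = 1"
    and gam: "- pi < \<gamma>" "\<gamma> \<le> pi"
  shows
   "(k12 \<noteq> 0 \<longrightarrow> has_eigs f q w N (S_bc k11 k12 k21 k22) N)
  \<and> (k12 = 0 \<longrightarrow> has_eigs f q w N (S_bc k11 k12 k21 k22) (N - 1))
  \<and> (f 0 * k22 - k21 \<noteq> 0 \<longrightarrow> has_eigs f q w N (V_bc k11 k12 k21 k22) N)
  \<and> (f 0 * k22 - k21 = 0 \<longrightarrow> has_eigs f q w N (V_bc k11 k12 k21 k22) (N - 1))
  \<and> (k12 = 0 \<longrightarrow>
       (\<forall>n\<le>N - 2. eigv f q w N (coupled_bc \<gamma> k11 k12 k21 k22) n \<le> eigv f q w N (S_bc k11 k12 k21 k22) n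
                 \<and> eigv f q w N (S_bc k11 k12 k21 k22) n \<le> eigv f q w N (coupled_bc \<gamma> k11 k12 k21 k22) (n + 1)))
  \<and> ((k11 - f 0 * k12) * k12 > 0 \<longrightarrow>
       (\<forall>n\<le>N - 1. eigv f q w N (S_bc k11 k12 k21 k22) n \<le> eigv f q w N (coupled_bc \<gamma> k11 k12 k21 k22) n)
     \<and> (\<forall>n\<le>N - 2. eigv f q w N (coupled_bc \<gamma> k11 k12 k21 k22) n \<le> eigv f q w N (S_bc k11 k12 k21 k22) (n + 1)))
  \<and> ((k11 - f 0 * k12) * k12 < 0 \<longrightarrow>
       (\<forall>n\<le>N - 1. eigv f q w N (coupled_bc \<gamma> k11 k12 k21 k22) n \<le> eigv f q w N (S_bc k11 k12 k21 k22) n)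
     \<and> (\<forall>n\<le>N - 2. eigv f q w N (S_bc k11 k12 k21 k22) n \<le> eigv f q w N (coupled_bc \<gamma> k11 k12 k21 k22) (n + 1)))
  \<and> (k11 - f 0 * k12 = 0 \<longrightarrow>
       (\<forall>n\<le>N - 2. eigv f q w N (S_bc k11 k12 k21 k22) n \<le> eigv f q w N (coupled_bc \<gamma> k11 k12 k21 k22) n
                 \<and> eigv f q w N (coupled_bc \<gamma> k11 k12 k21 k22) n \<le> eigv f q w N (S_bc k11 k12 k21 k22) (n + 1)))
  \<and> (f 0 * k22 - k21 = 0 \<longrightarrow>
       (\<forall>n\<le>N - 2. eigv f q w N (coupled_bc \<gamma> k11 k12 k21 k22) n \<le> eigv f q w N (V_bc k11 k12 k21 k22) n
                 \<and> eigv f q w N (V_bc k11 k12 k21 k22) n \<le> eigv f q w N (coupled_bc \<gamma> k11 k12 k21 k22) (n + 1)))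
  \<and> ((k11 - f 0 * k12) * (f 0 * k22 - k21) > 0 \<longrightarrow>
       (\<forall>n\<le>N - 1. eigv f q w N (V_bc k11 k12 k21 k22) n \<le> eigv f q w N (coupled_bc \<gamma> k11 k12 k21 k22) n)
     \<and> (\<forall>n\<le>N - 2. eigv f q w N (coupled_bc \<gamma> k11 k12 k21 k22) n \<le> eigv f q w N (V_bc k11 k12 k21 k22) (n + 1)))
  \<and> ((k11 - f 0 * k12) * (f 0 * k22 - k21) < 0 \<longrightarrow>
       (\<forall>n\<le>N - 1. eigv f q w N (coupled_bc \<gamma> k11 k12 k21 k22) n \<le> eigv f q w N (V_bc k11 k12 k21 k22) n)
     \<and> (\<forall>n\<le>N - 2. eigv f q w N (V_bc k11 k12 k21 k22) n \<le> eigv f q w N (coupled_bc \<gamma> k11 k12 k21 k22) (n + 1)))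
  \<and> (k11 - f 0 * k12 = 0 \<longrightarrow>
       (\<forall>n\<le>N - 2. eigv f q w N (V_bc k11 k12 k21 k22) n \<le> eigv f q w N (coupled_bc \<gamma> k11 k12 k21 k22) n
                 \<and> eigv f q w N (coupled_bc \<gamma> k11 k12 k21 k22) n \<le> eigv f q w N (V_bc k11 k12 k21 k22) (n + 1)))"
proof -
  interpret discrete_sl f q w N
    by unfold_locales (use N2 f_nz w_pos in auto)
  let ?\<phi> = "\<lambda>y :: nat \<Rightarrow> complex. of_real (f N) * (y (Suc N) - y N)"
  have linV: "?\<phi> (\<lambda>n. \<Sum>i\<in>I. c i * Y i n) = (\<Sum>i\<in>I. c i * ?\<phi> (Y i))"
    for I c and Y :: "nat \<Rightarrow> nat \<Rightarrow> complex"
    by (simp add: sum_distrib_left sum_subtractf algebra_simps)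
  have dS: "k11 - f 0 * k12 \<noteq> 0" if "k12 = 0" using SL2 that by auto
  have dV: "k11 - f 0 * k12 \<noteq> 0" if "f 0 * k22 - k21 = 0"
  proof
    assume "k11 - f 0 * k12 = 0"
    then have "k11 * k22 - k12 * k21 = k12 * (f 0 * k22 - k21)" by (simp add: algebra_simps)
    with that SL2 show False by simp
  qed
  \<comment> \<open>Two instances of the same scheme, with \<open>s = k12\<close> and
    \<open>s = f 0 * k22 - k21\<close>; \<open>refl\<close> proves the linearity of evaluation at
    0.\<close>
  note S = interlacing_cases[where \<phi> = "\<lambda>y. y 0", OF selfadjoint_S[OF SL2] ip_normal_S_self
      selfadjoint_coupled[OF SL2] ip_normal_coupled_self dS refl qf_coupled_minus_S[OF SL2]]
  note V = interlacing_cases[where \<phi> = ?\<phi>, OF selfadjoint_V[OF SL2] ip_normal_V_self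
      selfadjoint_coupled[OF SL2] ip_normal_coupled_self dV linV qf_coupled_minus_V[OF SL2]]
  show ?thesis
    by (intro conjI impI allI)
      (use has_eigs_S[OF SL2] has_eigs_V[OF SL2] in \<open>(simp; fail)\<close> | (rule S V; assumption))+
qed

end
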